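(* Let $D$ be a hereditary subalgebra of an approximately unital operator algebra $A$. Then every $f\in D^*$ has a unique Hahn–Banach extension to a functional in $A^*$, i.e. a unique $g\in A^*$ with $g|_D=f$ and $\|g\|=\|f\|$.
   Context: An operator algebra is a norm-closed subalgebra of $B(H)$; it is approximately unital if it has a contractive approximate identity. $A^{**}$ is an operator algebra and $S^{\perp\perp}$ denotes the weak* closure of $S\subset A$ in $A^{**}$. A projection $p\in A^{**}$ is open in $A^{**}$ if $p\in (pA^{**}p\cap A)^{\perp\perp}$, and a hereditary subalgebra of $A$ is a subalgebra of the form $pA^{**}p\cap A$ with $p$ open in $A^{**}$. *)

theory Defs
  imports "HOL-Analysis.Analysis"
begin

section \<open>The Hilbert space l2(I) (every complex Hilbert space is unitarily of this form)\<close>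

type_synonym 'i vec = "'i \<Rightarrow> complex"
type_synonym 'i op = "'i vec \<Rightarrow> 'i vec"

definition l2 :: "'i vec set" where
  "l2 = {x. (\<lambda>i. (cmod (x i))^2) summable_on UNIV}"

definition l2norm :: "'i vec \<Rightarrow> real" where
  "l2norm x = sqrt (infsum (\<lambda>i. (cmod (x i))^2) UNIV)"

definition l2inner :: "'i vec \<Rightarrow> 'i vec \<Rightarrow> complex" where
  "l2inner x y = infsum (\<lambda>i. cnj (x i) * y i) UNIV"

definition vadd :: "'i vec \<Rightarrow> 'i vec \<Rightarrow> 'i vec" where
  "vadd x y = (\<lambda>i. x i + y i)"

definition vscale :: "complex \<Rightarrow> 'i vec \<Rightarrow> 'i vec" where
  "vscale c x = (\<lambda>i. c * x i)"

definition BH :: "'i op set" where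
  "BH = {T. (\<forall>x\<in>l2. T x \<in> l2)
          \<and> (\<forall>x\<in>l2. \<forall>y\<in>l2. \<forall>c. T (vadd (vscale c x) y) = vadd (vscale c (T x)) (T y))
          \<and> (\<exists>K. \<forall>x\<in>l2. l2norm (T x) \<le> K * l2norm x)
          \<and> (\<forall>x. x \<notin> l2 \<longrightarrow> T x = (\<lambda>i. 0))}"

definition opnorm :: "'i op \<Rightarrow> real" where
  "opnorm T = Sup {l2norm (T x) | x. x \<in> l2 \<and> l2norm x \<le> 1}"

definition opadd :: "'i op \<Rightarrow> 'i op \<Rightarrow> 'i op" where
  "opadd S T = (\<lambda>x. vadd (S x) (T x))"

definition opscale :: "complex \<Rightarrow> 'i op \<Rightarrow> 'i op" where
  "opscale c T = (\<lambda>x. vscale c (T x))"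

definition opsub :: "'i op \<Rightarrow> 'i op \<Rightarrow> 'i op" where
  "opsub S T = opadd S (opscale (-1) T)"

definition opmult :: "'i op \<Rightarrow> 'i op \<Rightarrow> 'i op" where
  "opmult S T = S \<circ> T"

definition opadj :: "'i op \<Rightarrow> 'i op" where
  "opadj T = (THE S. S \<in> BH \<and> (\<forall>x\<in>l2. \<forall>y\<in>l2. l2inner (T x) y = l2inner x (S y)))"

definition norm_closed :: "'i op set \<Rightarrow> bool" where
  "norm_closed X \<longleftrightarrow> (\<forall>s T. (\<forall>n. s n \<in> X) \<longrightarrow> T \<in> BH \<longrightarrow>
       (\<lambda>n. opnorm (opsub (s n) T)) \<longlonglongrightarrow> 0 \<longrightarrow> T \<in> X)"

definition subalgebra_BH :: "'i op set \<Rightarrow> bool" where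
  "subalgebra_BH A \<longleftrightarrow> A \<subseteq> BH \<and> (\<lambda>x. \<lambda>i. 0) \<in> A
     \<and> (\<forall>a\<in>A. \<forall>b\<in>A. opadd a b \<in> A \<and> opmult a b \<in> A)
     \<and> (\<forall>a\<in>A. \<forall>c. opscale c a \<in> A)"

definition operator_algebra :: "'i op set \<Rightarrow> bool" where
  "operator_algebra A \<longleftrightarrow> subalgebra_BH A \<and> norm_closed A"

text \<open>Contractive approximate identity: a net (here a proper filter on the index = values) in the
  closed unit ball of A with e a \<rightarrow> a and a e \<rightarrow> a in norm, for all a in A.\<close>
definition approx_unital :: "'i op set \<Rightarrow> bool" where
  "approx_unital A \<longleftrightarrow> (\<exists>F :: 'i op filter. F \<noteq> bot
     \<and> eventually (\<lambda>e. e \<in> A \<and> opnorm e \<le> 1) F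
     \<and> (\<forall>a\<in>A. ((\<lambda>e. opnorm (opsub (opmult e a) a)) \<longlongrightarrow> 0) F
               \<and> ((\<lambda>e. opnorm (opsub (opmult a e) a)) \<longlongrightarrow> 0) F))"

definition dual :: "'i op set \<Rightarrow> ('i op \<Rightarrow> complex) set" where
  "dual X = {\<phi>. (\<forall>a\<in>X. \<forall>b\<in>X. \<forall>c. \<phi> (opadd (opscale c a) b) = c * \<phi> a + \<phi> b)
              \<and> (\<exists>K. \<forall>a\<in>X. cmod (\<phi> a) \<le> K * opnorm a)
              \<and> (\<forall>a. a \<notin> X \<longrightarrow> \<phi> a = 0)}"

definition fnorm :: "'i op set \<Rightarrow> ('i op \<Rightarrow> complex) \<Rightarrow> real" where
  "fnorm X \<phi> = Sup {cmod (\<phi> a) | a. a \<in> X \<and> opnorm a \<le> 1}"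

definition bidual :: "'i op set \<Rightarrow> (('i op \<Rightarrow> complex) \<Rightarrow> complex) set" where
  "bidual X = {m. (\<forall>\<phi>\<in>dual X. \<forall>\<psi>\<in>dual X. \<forall>c. m (\<lambda>a. c * \<phi> a + \<psi> a) = c * m \<phi> + m \<psi>)
              \<and> (\<exists>K. \<forall>\<phi>\<in>dual X. cmod (m \<phi>) \<le> K * fnorm X \<phi>)
              \<and> (\<forall>\<phi>. \<phi> \<notin> dual X \<longrightarrow> m \<phi> = 0)}"

definition canon :: "'i op set \<Rightarrow> 'i op \<Rightarrow> (('i op \<Rightarrow> complex) \<Rightarrow> complex)" where
  "canon X a = (\<lambda>\<phi>. if \<phi> \<in> dual X then \<phi> a else 0)"

definition fmod_r :: "'i op set \<Rightarrow> ('i op \<Rightarrow> complex) \<Rightarrow> 'i op \<Rightarrow> ('i op \<Rightarrow> complex)" where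
  "fmod_r X \<phi> a = (\<lambda>b. if b \<in> X then \<phi> (opmult a b) else 0)"

definition bmod :: "'i op set \<Rightarrow> (('i op \<Rightarrow> complex) \<Rightarrow> complex) \<Rightarrow> ('i op \<Rightarrow> complex) \<Rightarrow> ('i op \<Rightarrow> complex)" where
  "bmod X n \<phi> = (\<lambda>a. if a \<in> X then n (fmod_r X \<phi> a) else 0)"

definition arens :: "'i op set \<Rightarrow> (('i op \<Rightarrow> complex) \<Rightarrow> complex) \<Rightarrow> (('i op \<Rightarrow> complex) \<Rightarrow> complex)
                      \<Rightarrow> (('i op \<Rightarrow> complex) \<Rightarrow> complex)" where
  "arens X m n = (\<lambda>\<phi>. if \<phi> \<in> dual X then m (bmod X n \<phi>) else 0)"

text \<open>Embedding A** \<rightarrow> B(H)** (dual of the restriction map B(H)* \<rightarrow> A*), and the involution of B(H)**.\<close>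
definition bid_incl :: "'i op set \<Rightarrow> (('i op \<Rightarrow> complex) \<Rightarrow> complex) \<Rightarrow> (('i op \<Rightarrow> complex) \<Rightarrow> complex)" where
  "bid_incl X m = (\<lambda>\<psi>. if \<psi> \<in> dual BH then m (\<lambda>a. if a \<in> X then \<psi> a else 0) else 0)"

definition fstar :: "('i op \<Rightarrow> complex) \<Rightarrow> ('i op \<Rightarrow> complex)" where
  "fstar \<psi> = (\<lambda>T. if T \<in> BH then cnj (\<psi> (opadj T)) else 0)"

definition bstar :: "(('i op \<Rightarrow> complex) \<Rightarrow> complex) \<Rightarrow> (('i op \<Rightarrow> complex) \<Rightarrow> complex)" where
  "bstar m = (\<lambda>\<psi>. if \<psi> \<in> dual BH then cnj (m (fstar \<psi>)) else 0)"

text \<open>Projection in A**: an idempotent of A** that is self-adjoint in B(H)** (i.e. in C*(A)**).\<close>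
definition projection_bidual :: "'i op set \<Rightarrow> (('i op \<Rightarrow> complex) \<Rightarrow> complex) \<Rightarrow> bool" where
  "projection_bidual A p \<longleftrightarrow> p \<in> bidual A \<and> arens A p p = p
      \<and> bstar (bid_incl A p) = bid_incl A p"

definition wstar_closure :: "'i op set \<Rightarrow> 'i op set \<Rightarrow> (('i op \<Rightarrow> complex) \<Rightarrow> complex) set" where
  "wstar_closure X S = {m \<in> bidual X. \<forall>F e. finite F \<longrightarrow> F \<subseteq> dual X \<longrightarrow> e > 0 \<longrightarrow>
        (\<exists>s\<in>S. \<forall>\<phi>\<in>F. cmod (m \<phi> - \<phi> s) < e)}"

definition corner :: "'i op set \<Rightarrow> (('i op \<Rightarrow> complex) \<Rightarrow> complex) \<Rightarrow> 'i op set" where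
  "corner A p = {a \<in> A. \<exists>m\<in>bidual A. canon A a = arens A (arens A p m) p}"

definition open_projection :: "'i op set \<Rightarrow> (('i op \<Rightarrow> complex) \<Rightarrow> complex) \<Rightarrow> bool" where
  "open_projection A p \<longleftrightarrow> projection_bidual A p \<and> p \<in> wstar_closure A (corner A p)"

definition hereditary_subalgebra :: "'i op set \<Rightarrow> 'i op set \<Rightarrow> bool" where
  "hereditary_subalgebra A D \<longleftrightarrow> (\<exists>p. open_projection A p \<and> D = corner A p)"

end

theory Submission
  imports Defs "HOL-Library.Function_Algebras"
begin

text \<open>
  Let p be the open projection with D = pA**p \<inter> A. Self-adjointness of p gives \<open>x\<^sup>* p = x\<^sup>* = p x\<^sup>*\<close>
  in the bidual of B(H) for x in D. Since p is a weak* limit of elements of D, a Hahn--Banach argument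
  turns this into norm estimates: there is a constant K such that for each x in D some d in D of norm at
  most K makes \<open>x\<^sup>* - x\<^sup>* d\<close> as small as desired, and likewise \<open>x\<^sup>* - d x\<^sup>*\<close>.
  If x has norm at most 1, then \<open>\<parallel>x + \<epsilon> (a - d a)\<parallel>\<^sup>2 \<le> 1 + \<epsilon>\<^sup>2 \<parallel>a - d a\<parallel>\<^sup>2\<close> up to a small error, because
  the cross term is \<open>x\<^sup>* (a - d a)\<close>. Choosing x in D almost norming for f, any norm-preserving
  extension g of f satisfies \<open>\<parallel>g\<parallel> + \<epsilon> \<bar>g (a - d a)\<bar> \<le> \<parallel>g\<parallel> (1 + O(\<epsilon>\<^sup>2))\<close> up to a small error, so that
  \<open>g (a - d a)\<close> is small. Together with the same estimate on the right, g(a) is approximated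
  by \<open>g (d a e) = f (d a e)\<close> with d a e in D, and therefore depends on f only.
\<close>

section \<open>The Hahn--Banach theorem\<close>

text \<open>\<open>A\<close> need not be self-adjoint, so x^* may lie outside \<open>A\<close>,
  while p acts only on functionals of \<open>A\<close>. Identities such as x^* p = x^* are therefore
  tested on functionals: a functional \<xi> on B(H) is translated by x^*, restricted to
  \<open>A\<close> and fed to p. Passing to the adjoint functional turns the translation by x^* into
  one by x, which stays inside \<open>A\<close>. The estimates concern x^* rather than x because the
  cross term in the squared norm of x + y is x^* y. The constant K is a bound for p as a functional,
  increased by 1; it enters only the coefficient of \<epsilon>^2. The gain \<epsilon> |g(a - d a)|
  is of first order. So x norms f up to \<epsilon>^2, and x^* d approximates x^* up to \<epsilon>,
  the cross term carrying a second factor \<epsilon> of its own; all losses are then of second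
  order. Both sides of a are cut down because the hereditary property puts d a e, and in general not
  d a, into D.\<close>

definition sublinear_on :: "'a::real_vector set \<Rightarrow> ('a \<Rightarrow> real) \<Rightarrow> bool" where
  "sublinear_on V q \<longleftrightarrow> (\<forall>x\<in>V. \<forall>y\<in>V. q (x + y) \<le> q x + q y)
     \<and> (\<forall>x\<in>V. \<forall>r\<ge>0. q (r *\<^sub>R x) = r * q x)"

lemma sublinear_on_add: "sublinear_on V q \<Longrightarrow> x \<in> V \<Longrightarrow> y \<in> V \<Longrightarrow> q (x + y) \<le> q x + q y"
  and sublinear_on_scale: "sublinear_on V q \<Longrightarrow> x \<in> V \<Longrightarrow> r \<ge> 0 \<Longrightarrow> q (r *\<^sub>R x) = r * q x"
  by (auto simp: sublinear_on_def)

lemma sublinear_on_zero: "sublinear_on V q \<Longrightarrow> 0 \<in> V \<Longrightarrow> q 0 = 0"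
  using sublinear_on_scale[of V q 0 0] by simp

lemma sublinear_on_uminus:
  assumes "subspace V" "sublinear_on V q" "x \<in> V"
  shows "- q (- x) \<le> q x"
  using sublinear_on_add[OF assms(2,3) subspace_neg[OF assms(1,3)]]
    sublinear_on_zero[OF assms(2) subspace_0[OF assms(1)]] by simp

text \<open>The opposite inequality is the assumed one at \<open>r *\<^sub>R x\<close> with the
  factor \<open>inverse r\<close>. For the infima constructed below, only upper bounds then have to
  be checked.\<close>

lemma pos_homogeneousI:
  assumes V: "subspace V" and z: "q 0 = (0::real)"
    and le: "\<And>x r. x \<in> V \<Longrightarrow> r > 0 \<Longrightarrow> q (r *\<^sub>R x) \<le> r * q x"
    and x: "x \<in> V" and r: "r \<ge> 0"
  shows "q (r *\<^sub>R x) = r * q x"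
proof (cases "r = 0")
  case False
  then have r: "r > 0" using r by simp
  have "q x \<le> inverse r * q (r *\<^sub>R x)"
    using le[of "r *\<^sub>R x" "inverse r"] r subspace_scale[OF V x] by simp
  then have "r * q x \<le> q (r *\<^sub>R x)"
    using r by (simp add: field_simps)
  with le[OF x r] show ?thesis by simp
qed (use z in simp)

text \<open>\<open>W\<close> is a convex cone rather than a subspace because the construction serves
  twice: on a subspace it forces an extension of \<open>f\<close>, on a ray it shows that minimal
  sublinear functions are odd.\<close>

lemma sublinear_on_inf_convolution:
  assumes V: "subspace V" and q: "sublinear_on V q"
    and W: "W \<subseteq> V" "0 \<in> W" "\<And>x y. x \<in> W \<Longrightarrow> y \<in> W \<Longrightarrow> x + y \<in> W"
      "\<And>x r. x \<in> W \<Longrightarrow> r > 0 \<Longrightarrow> r *\<^sub>R x \<in> W"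
    and f: "\<And>x y. x \<in> W \<Longrightarrow> y \<in> W \<Longrightarrow> f (x + y) = f x + f y"
      "\<And>x r. x \<in> W \<Longrightarrow> r > 0 \<Longrightarrow> f (r *\<^sub>R x) = r * f x"
      "\<And>x. x \<in> W \<Longrightarrow> f x \<le> q x"
  obtains q' where "sublinear_on V q'" "\<And>v. v \<in> V \<Longrightarrow> q' v \<le> q v"
    "\<And>w. w \<in> W \<Longrightarrow> q' (- w) \<le> - f w"
proof -
  define q' where "q' v = (INF w\<in>W. q (v + w) - f w)" for v
  have f0: "f 0 = 0" using f(1)[OF W(2) W(2)] by simp
  have q0: "q 0 = 0" using sublinear_on_zero[OF q] W by blast
  \<comment> \<open>Domination of \<open>f\<close> by \<open>q\<close> keeps the infimum finite: q(v
    + w) + q(-v) \<ge> q(w) \<ge> f(w).\<close>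
  have lower: "- q (- v) \<le> q (v + w) - f w" if "v \<in> V" "w \<in> W" for v w
    using sublinear_on_add[OF q, of "v + w" "- v"] f(3)[OF that(2)] that W(1) V
    by (auto simp: subspace_add subspace_neg subset_iff)
  have bdd: "bdd_below ((\<lambda>w. q (v + w) - f w) ` W)" if "v \<in> V" for v
    by (rule bdd_belowI2[where m = "- q (- v)"]) (rule lower[OF that])
  have le: "q' v \<le> q (v + w) - f w" if "v \<in> V" "w \<in> W" for v w
    unfolding q'_def by (rule cINF_lower[OF bdd[OF that(1)] that(2)])
  have glb: "c \<le> q' v" if "\<And>w. w \<in> W \<Longrightarrow> c \<le> q (v + w) - f w" for c v
    unfolding q'_def by (rule cINF_greatest) (use W(2) that in auto)
  have q'0: "q' 0 = 0"
    using le[OF subspace_0[OF V] W(2)] glb[of 0 0] f(3) f0 q0 by force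
  have add: "q' (x + y) \<le> q' x + q' y" if xy: "x \<in> V" "y \<in> V" for x y
  proof -
    have "q' (x + y) - (q (x + w) - f w) \<le> q' y" if w: "w \<in> W" for w
    proof (rule glb)
      fix u assume u: "u \<in> W"
      have "q (x + w + (y + u)) \<le> q (x + w) + q (y + u)"
        by (rule sublinear_on_add[OF q]) (use xy u w W(1) V in \<open>auto intro: subspace_add\<close>)
      moreover have "q' (x + y) \<le> q (x + y + (w + u)) - f (w + u)"
        by (rule le) (use xy V W(3)[OF w u] in \<open>auto intro: subspace_add\<close>)
      ultimately show "q' (x + y) - (q (x + w) - f w) \<le> q (y + u) - f u"
        using f(1)[OF w u] by (simp add: algebra_simps)
    qed
    then have "q' (x + y) - q' y \<le> q' x" by (intro glb) (auto simp: algebra_simps)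
    then show ?thesis by simp
  qed
  have "q' (r *\<^sub>R x) \<le> r * q' x" if x: "x \<in> V" and r: "r > 0" for x r
  proof -
    have "q' (r *\<^sub>R x) / r \<le> q' x"
    proof (rule glb)
      fix w assume w: "w \<in> W"
      have "q' (r *\<^sub>R x) \<le> q (r *\<^sub>R x + r *\<^sub>R w) - f (r *\<^sub>R w)"
        by (rule le) (use x w W r V in \<open>auto intro: subspace_scale\<close>)
      also have "q (r *\<^sub>R x + r *\<^sub>R w) = r * q (x + w)"
        using sublinear_on_scale[OF q, of "x + w" r] x w W r V
        by (auto simp: scaleR_add_right intro: subspace_add)
      finally show "q' (r *\<^sub>R x) / r \<le> q (x + w) - f w"
        using f(2)[OF w r] r by (simp add: field_simps)
    qed
    then show ?thesis using r by (simp add: field_simps)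
  qed
  then have "sublinear_on V q'"
    using add pos_homogeneousI[of V q', OF V q'0] by (auto simp: sublinear_on_def)
  moreover have "q' v \<le> q v" if "v \<in> V" for v using le[OF that W(2)] f0 by simp
  moreover have "q' (- w) \<le> - f w" if "w \<in> W" for w
    using le[of "- w" w] that W(1) V q0 by (auto intro: subspace_neg)
  ultimately show ?thesis using that by blast
qed

text \<open>Zorn's lemma for the reversed pointwise order. A chain is bounded by its pointwise
  infimum, which is finite because each member m satisfies m(v) \<ge> -m(-v) \<ge> -q(-v).\<close>

lemma minimal_sublinear_on:
  assumes V: "subspace V" and q: "sublinear_on V q"
  obtains l where "sublinear_on V l" "\<forall>v\<in>V. l v \<le> q v"
    "\<forall>m. sublinear_on V m \<longrightarrow> (\<forall>v\<in>V. m v \<le> l v) \<longrightarrow> (\<forall>v\<in>V. m v = l v)"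
proof -
  \<comment> \<open>Values off \<open>V\<close> are unconstrained and could be lowered forever;
    normalising them to 0 makes minimal elements possible.\<close>
  define cut where "cut m v = (if v \<in> V then m v else 0)" for m :: "'a \<Rightarrow> real" and v
  have sub_cut: "sublinear_on V (cut m)" if "sublinear_on V m" for m
    using that V by (auto simp: sublinear_on_def cut_def subspace_add subspace_scale)
  define S where "S = {m. sublinear_on V m \<and> (\<forall>v\<in>V. m v \<le> q v) \<and> (\<forall>v. v \<notin> V \<longrightarrow> m v = 0)}"
  define P where "P m n \<longleftrightarrow> (\<forall>v. n v \<le> m v)" for m n :: "'a \<Rightarrow> real"
  have "partial_order_on S (relation_of P S)"
    by (rule partial_order_on_relation_ofI) (auto simp: P_def fun_eq_iff intro: order_trans antisym)
  moreover have "\<exists>u\<in>S. \<forall>a\<in>C. P a u" if C: "C \<in> Chains (relation_of P S)" for C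
  proof (cases "C = {}")
    case True
    then show ?thesis using sub_cut[OF q] by (auto simp: S_def cut_def intro!: bexI[of _ "cut q"])
  next
    case False
    have CS: "C \<subseteq> S" and tot: "\<And>a b. a \<in> C \<Longrightarrow> b \<in> C \<Longrightarrow> P a b \<or> P b a"
      using C by (auto simp: Chains_def relation_of_def)
    define u where "u v = (INF m\<in>C. m v)" for v
    have lower: "- q (- v) \<le> m v" if "m \<in> C" "v \<in> V" for m v
      using sublinear_on_uminus[OF V, of m v] subspace_neg[OF V that(2)] CS that
      by (force simp: S_def)
    have bdd: "bdd_below ((\<lambda>m. m v) ` C)" if "v \<in> V" for v
      by (rule bdd_belowI2[where m = "- q (- v)"]) (rule lower[OF _ that])
    have le: "u v \<le> m v" if "v \<in> V" "m \<in> C" for v m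
      unfolding u_def by (rule cINF_lower[OF bdd[OF that(1)] that(2)])
    have glb: "c \<le> u v" if "\<And>m. m \<in> C \<Longrightarrow> c \<le> m v" for c v
      unfolding u_def by (rule cINF_greatest) (use False that in auto)
    have out: "u v = 0" if "v \<notin> V" for v
    proof -
      have "m v = 0" if "m \<in> C" for m using CS that \<open>v \<notin> V\<close> by (auto simp: S_def)
      then have "(\<lambda>m. m v) ` C = {0}" using False by force
      then show ?thesis by (simp add: u_def)
    qed
    have u0: "u 0 = 0"
    proof -
      have "m 0 = 0" if "m \<in> C" for m
        by (rule sublinear_on_zero[of V]) (use CS that subspace_0[OF V] in \<open>auto simp: S_def\<close>)
      then have "(\<lambda>m. m 0) ` C = {0}" using False by force
      then show ?thesis by (simp add: u_def)
    qed
    have add: "u (x + y) \<le> u x + u y" if xy: "x \<in> V" "y \<in> V" for x y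
    proof -
      have "u (x + y) - m x \<le> u y" if m: "m \<in> C" for m
      proof (rule glb)
        fix n assume n: "n \<in> C"
        \<comment> \<open>In a chain the smaller of m and n lies below both, so subadditivity of
          this one function bounds the infimum at x + y by m x + n y.\<close>
        obtain k where k: "k \<in> C" "\<And>v. k v \<le> m v" "\<And>v. k v \<le> n v"
          using tot[OF m n] m n by (auto simp: P_def)
        have "u (x + y) \<le> k (x + y)" by (rule le) (use xy V k in \<open>auto intro: subspace_add\<close>)
        also have "\<dots> \<le> k x + k y"
          by (rule sublinear_on_add[of V]) (use xy CS k in \<open>auto simp: S_def\<close>)
        also have "\<dots> \<le> m x + n y" using k by (intro add_mono)
        finally show "u (x + y) - m x \<le> n y" by simp
      qed
      then have "u (x + y) - u y \<le> u x" by (intro glb) (auto simp: algebra_simps)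
      then show ?thesis by simp
    qed
    have "u (r *\<^sub>R x) \<le> r * u x" if x: "x \<in> V" and r: "r > 0" for x r
    proof -
      have "u (r *\<^sub>R x) / r \<le> u x"
      proof (rule glb)
        fix m assume m: "m \<in> C"
        have "u (r *\<^sub>R x) \<le> m (r *\<^sub>R x)" by (rule le) (use x m V in \<open>auto intro: subspace_scale\<close>)
        also have "\<dots> = r * m x"
          by (rule sublinear_on_scale[of V]) (use x m r CS in \<open>auto simp: S_def\<close>)
        finally show "u (r *\<^sub>R x) / r \<le> m x" using r by (simp add: field_simps)
      qed
      then show ?thesis using r by (simp add: field_simps)
    qed
    then have "sublinear_on V u"
      using add pos_homogeneousI[of V u, OF V u0] by (auto simp: sublinear_on_def)
    moreover have "u v \<le> q v" if "v \<in> V" for v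
    proof -
      obtain m where "m \<in> C" using False by blast
      then show ?thesis using le[OF that] CS that by (force simp: S_def)
    qed
    ultimately have "u \<in> S" using out by (auto simp: S_def)
    moreover have "P m u" if "m \<in> C" for m
      unfolding P_def
    proof
      fix v show "u v \<le> m v"
        using le[OF _ that] out CS that by (cases "v \<in> V") (auto simp: S_def)
    qed
    ultimately show ?thesis by blast
  qed
  ultimately obtain l where l: "l \<in> S" and min: "\<And>m. m \<in> S \<Longrightarrow> P l m \<Longrightarrow> m = l"
    using predicate_Zorn[of S P] by blast
  have "m v = l v" if m: "sublinear_on V m" "\<forall>v\<in>V. m v \<le> l v" and v: "v \<in> V" for m v
  proof -
    have "m v \<le> q v" if "v \<in> V" for v
      using m(2) l that by (auto simp: S_def intro: order_trans)
    then have "cut m \<in> S" using sub_cut[OF m(1)] by (auto simp: S_def cut_def)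
    moreover have "P l (cut m)" using m(2) l by (auto simp: P_def cut_def S_def)
    ultimately have "cut m = l" by (rule min)
    then show ?thesis using v by (auto simp: cut_def)
  qed
  moreover have "sublinear_on V l" "\<forall>v\<in>V. l v \<le> q v" using l by (auto simp: S_def)
  ultimately show ?thesis using that by blast
qed

text \<open>Convolving with the restriction of \<open>l\<close> to a ray cannot lower a minimal \<open>l\<close>, which forces
  \<open>l (- y) \<le> - l y\<close>.\<close>

lemma minimal_sublinear_on_linear:
  assumes V: "subspace V" and l: "sublinear_on V l"
    and min: "\<forall>m. sublinear_on V m \<longrightarrow> (\<forall>v\<in>V. m v \<le> l v) \<longrightarrow> (\<forall>v\<in>V. m v = l v)"
  shows "\<And>x. x \<in> V \<Longrightarrow> l (- x) = - l x"
    and "\<And>x y. x \<in> V \<Longrightarrow> y \<in> V \<Longrightarrow> l (x + y) = l x + l y"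
    and "\<And>x r. x \<in> V \<Longrightarrow> l (r *\<^sub>R x) = r * l x"
proof -
  show neg: "l (- y) = - l y" if y: "y \<in> V" for y
  proof -
    define W where "W = {t *\<^sub>R y | t. t \<ge> 0}"
    have lW: "l (t *\<^sub>R y) = t * l y" if "t \<ge> 0" for t
      by (rule sublinear_on_scale[OF l y that])
    have W_add: "u + v \<in> W \<and> l (u + v) = l u + l v" if "u \<in> W" "v \<in> W" for u v
    proof -
      obtain s t where "s \<ge> 0" "t \<ge> 0" "u = s *\<^sub>R y" "v = t *\<^sub>R y"
        using \<open>u \<in> W\<close> \<open>v \<in> W\<close> by (auto simp: W_def)
      then show ?thesis
        using lW[of s] lW[of t] lW[of "s + t"]
        by (auto simp: W_def algebra_simps intro!: exI[of _ "s + t"])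
    qed
    have W_scale: "r *\<^sub>R u \<in> W \<and> l (r *\<^sub>R u) = r * l u" if u: "u \<in> W" and "r > 0" for u r
    proof -
      obtain s where "s \<ge> 0" "u = s *\<^sub>R y" using u by (auto simp: W_def)
      then show ?thesis
        using lW[of s] lW[of "r * s"] \<open>r > 0\<close> by (auto simp: W_def intro!: exI[of _ "r * s"])
    qed
    have WV: "W \<subseteq> V" using V y by (auto simp: W_def intro: subspace_scale)
    have W0: "0 \<in> W" by (auto simp: W_def intro!: exI[of _ 0])
    have yW: "y \<in> W" by (auto simp: W_def intro!: exI[of _ 1])
    obtain m where m: "sublinear_on V m" "\<And>v. v \<in> V \<Longrightarrow> m v \<le> l v" "\<And>w. w \<in> W \<Longrightarrow> m (- w) \<le> - l w"
      by (rule sublinear_on_inf_convolution[OF V l WV W0, of l]) (use W_add W_scale in auto)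
    have "l (- y) \<le> - l y"
      using m(3)[OF yW] min[rule_format, OF m(1), of "- y"] m(2) subspace_neg[OF V y] by simp
    with sublinear_on_uminus[OF V l y] show ?thesis by simp
  qed
  show "l (x + y) = l x + l y" if xy: "x \<in> V" "y \<in> V" for x y
    using sublinear_on_add[OF l xy] neg[OF xy(2)]
      sublinear_on_add[OF l, of "x + y" "- y"] subspace_add[OF V xy] subspace_neg[OF V xy(2)]
    by simp
  show "l (r *\<^sub>R x) = r * l x" if x: "x \<in> V" for x r
  proof (cases "r \<ge> 0")
    case False
    then have "l ((- r) *\<^sub>R x) = - r * l x" using sublinear_on_scale[OF l x, of "- r"] by simp
    then show ?thesis using neg[of "r *\<^sub>R x"] subspace_scale[OF V x] by simp
  qed (use sublinear_on_scale[OF l x] in auto)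
qed

text \<open>The convolution lowers \<open>q\<close> to a \<open>q'\<close> whose minorants satisfy
  l(-w) \<le> -f(w) on \<open>W\<close>. For linear l this reads l \<ge> f on \<open>W\<close>, and
  at -w it reads l \<le> f. Hence every linear minorant of \<open>q'\<close> extends
  \<open>f\<close>, and a minimal sublinear function below \<open>q'\<close> is one.\<close>

theorem hahn_banach_real:
  assumes V: "subspace V" and q: "sublinear_on V q" and W: "subspace W" "W \<subseteq> V"
    and f: "\<And>x y. x \<in> W \<Longrightarrow> y \<in> W \<Longrightarrow> f (x + y) = f x + f y"
      "\<And>x r. x \<in> W \<Longrightarrow> f (r *\<^sub>R x) = r * f x"
      "\<And>x. x \<in> W \<Longrightarrow> f x \<le> q x"
  obtains l where "\<And>x y. x \<in> V \<Longrightarrow> y \<in> V \<Longrightarrow> l (x + y) = l x + l y"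
      "\<And>x r. x \<in> V \<Longrightarrow> l (r *\<^sub>R x) = r * l x"
      "\<And>x. x \<in> V \<Longrightarrow> l x \<le> q x" "\<And>x. x \<in> W \<Longrightarrow> l x = f x"
proof -
  obtain q' where q': "sublinear_on V q'" "\<And>v. v \<in> V \<Longrightarrow> q' v \<le> q v"
      "\<And>w. w \<in> W \<Longrightarrow> q' (- w) \<le> - f w"
    by (rule sublinear_on_inf_convolution[OF V q W(2) subspace_0[OF W(1)], of f])
      (use f W in \<open>auto intro: subspace_add subspace_scale\<close>)
  obtain l where l: "sublinear_on V l" "\<forall>v\<in>V. l v \<le> q' v"
      and min: "\<forall>m. sublinear_on V m \<longrightarrow> (\<forall>v\<in>V. m v \<le> l v) \<longrightarrow> (\<forall>v\<in>V. m v = l v)"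
    using minimal_sublinear_on[OF V q'(1)] by blast
  note lin = minimal_sublinear_on_linear[OF V l(1) min]
  have upper: "l (- w) \<le> - f w" if "w \<in> W" for w
    using l(2) q'(3)[OF that] subspace_neg[OF V, of w] that W(2) by force
  have "l w = f w" if w: "w \<in> W" for w
  proof -
    have "f (- w) = - f w" using f(2)[OF w, of "-1"] by simp
    then show ?thesis
      using upper[OF w] upper[OF subspace_neg[OF W(1) w]] lin(1)[of w] w W(2) by auto
  qed
  moreover have "l x \<le> q x" if "x \<in> V" for x using l(2) q'(2) that by force
  ultimately show ?thesis using that lin(2,3) by blast
qed

section \<open>Operators as a vector space, and complex-linear functionals\<close>

instantiation "fun" :: (type, real_vector) real_vector
begin

definition scaleR_fun_def: "r *\<^sub>R f = (\<lambda>x. r *\<^sub>R f x)"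

instance
  by standard (auto simp: scaleR_fun_def fun_eq_iff algebra_simps)

end

lemma scaleR_fun_apply [simp]: "(r *\<^sub>R f) x = r *\<^sub>R f x"
  by (simp add: scaleR_fun_def)

lemma opadd_eq_plus: "opadd S T = S + T"
  by (simp add: opadd_def vadd_def fun_eq_iff)

lemma opscale_apply [simp]: "opscale c T x i = c * T x i"
  by (simp add: opscale_def vscale_def)

lemma zero_op: "(\<lambda>x. \<lambda>i. 0) = (0 :: 'i op)"
  by (simp add: fun_eq_iff)

lemma opscale_algebra:
  "opscale c (S + T) = opscale c S + opscale c T" "opscale (c + d) S = opscale c S + opscale d S"
  "opscale c (opscale d S) = opscale (c * d) S" "opscale 1 S = S" "opscale 0 S = 0"
  "opscale c 0 = 0" "opscale (of_real r) S = r *\<^sub>R S" "opscale (-1) S = - S"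
  by (simp_all add: fun_eq_iff algebra_simps scaleR_conv_of_real)

definition op_subspace :: "'i op set \<Rightarrow> bool" where
  "op_subspace V \<longleftrightarrow> 0 \<in> V \<and> (\<forall>x\<in>V. \<forall>y\<in>V. x + y \<in> V) \<and> (\<forall>x\<in>V. \<forall>c. opscale c x \<in> V)"

lemma op_subspace_0: "op_subspace V \<Longrightarrow> 0 \<in> V"
  and op_subspace_add: "op_subspace V \<Longrightarrow> x \<in> V \<Longrightarrow> y \<in> V \<Longrightarrow> x + y \<in> V"
  and op_subspace_scale: "op_subspace V \<Longrightarrow> x \<in> V \<Longrightarrow> opscale c x \<in> V"
  by (auto simp: op_subspace_def)

lemma op_subspace_diff: "op_subspace V \<Longrightarrow> x \<in> V \<Longrightarrow> y \<in> V \<Longrightarrow> x - y \<in> V"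
  using op_subspace_add[of V x "opscale (-1) y"] op_subspace_scale[of V y "-1"]
  by (simp add: opscale_algebra)

lemma op_subspace_imp_subspace: "op_subspace V \<Longrightarrow> subspace V"
  by (auto simp: op_subspace_def subspace_def opscale_algebra(7)[symmetric])

definition op_linear_on :: "'i op set \<Rightarrow> ('i op \<Rightarrow> complex) \<Rightarrow> bool" where
  "op_linear_on V f \<longleftrightarrow> (\<forall>x\<in>V. \<forall>y\<in>V. \<forall>c. f (opscale c x + y) = c * f x + f y)"

lemma op_linear_on_add:
  "op_linear_on V f \<Longrightarrow> x \<in> V \<Longrightarrow> y \<in> V \<Longrightarrow> f (x + y) = f x + f y"
  using opscale_algebra(4)[of x] by (metis mult_1 op_linear_on_def)

lemma op_linear_on_scale:
  assumes "op_subspace V" "op_linear_on V f" "x \<in> V"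
  shows "f (opscale c x) = c * f x"
proof -
  have 0: "0 \<in> V" using assms by (simp add: op_subspace_0)
  have "f 0 = 0" using op_linear_on_add[OF assms(2) 0 0] by simp
  then show ?thesis
    using assms(2,3) 0 by (metis add.right_neutral op_linear_on_def)
qed

lemma op_linear_on_diff:
  assumes "op_subspace V" "op_linear_on V f" "x \<in> V" "y \<in> V"
  shows "f (x - y) = f x - f y"
  using op_linear_on_add[OF assms(2,3), of "opscale (-1) y"]
    op_linear_on_scale[OF assms(1,2,4), of "-1"] op_subspace_scale[OF assms(1,4), of "-1"]
  by (simp add: opscale_algebra)

text \<open>Rotating by this phase turns a modulus into a value of a linear functional, which is how
  bounds on real parts become bounds on moduli.\<close>

lemma ex_phase: "\<exists>b::complex. cmod b = 1 \<and> b * z = of_real (cmod z)"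
proof (cases "z = 0")
  case True
  then show ?thesis by (intro exI[of _ 1]) simp
next
  case False
  have "cnj z / of_real (cmod z) * z = of_real (cmod z)"
    using False complex_norm_square[of z] by (simp add: field_simps power2_eq_square)
  then show ?thesis
    using False by (intro exI[of _ "cnj z / of_real (cmod z)"]) (simp add: norm_divide)
qed

text \<open>A complex-linear g is recovered from its real part l by g(x) = l(x) - i l(i x). So only
  the real part of \<open>f\<close> is extended, and the bound for |g| follows by rotating x until
  g(x) is real and nonnegative.\<close>

theorem hahn_banach_complex:
  assumes V: "op_subspace V" and W: "op_subspace W" "W \<subseteq> V"
    and q: "\<And>x y. x \<in> V \<Longrightarrow> y \<in> V \<Longrightarrow> q (x + y) \<le> q x + q y"
      "\<And>x c. x \<in> V \<Longrightarrow> q (opscale c x) = cmod c * q x"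
    and f: "op_linear_on W f" "\<And>x. x \<in> W \<Longrightarrow> cmod (f x) \<le> q x"
  obtains g where "op_linear_on V g" "\<And>x. x \<in> V \<Longrightarrow> cmod (g x) \<le> q x"
      "\<And>x. x \<in> W \<Longrightarrow> g x = f x"
proof -
  note W_scale = op_linear_on_scale[OF W(1) f(1)]
  have sub: "sublinear_on V q"
    using q(1) q(2)[of _ "of_real _"] by (auto simp: sublinear_on_def opscale_algebra(7))
  obtain l where l: "\<And>x y. x \<in> V \<Longrightarrow> y \<in> V \<Longrightarrow> l (x + y) = l x + l y"
      "\<And>x r. x \<in> V \<Longrightarrow> l (r *\<^sub>R x) = r * l x"
      "\<And>x. x \<in> V \<Longrightarrow> l x \<le> q x" "\<And>x. x \<in> W \<Longrightarrow> l x = Re (f x)"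
  proof (rule hahn_banach_real[OF op_subspace_imp_subspace[OF V] sub
        op_subspace_imp_subspace[OF W(1)] W(2), of "\<lambda>x. Re (f x)"])
    show "Re (f (x + y)) = Re (f x) + Re (f y)" if "x \<in> W" "y \<in> W" for x y
      using op_linear_on_add[OF f(1) that] by simp
    show "Re (f (r *\<^sub>R x)) = r * Re (f x)" if "x \<in> W" for x r
      using W_scale[OF that, of "of_real r"] by (simp add: opscale_algebra)
    show "Re (f x) \<le> q x" if "x \<in> W" for x
      using f(2)[OF that] complex_Re_le_cmod[of "f x"] by linarith
  qed blast
  note V_scale = op_subspace_scale[OF V]
  define g where "g x = Complex (l x) (- l (opscale \<i> x))" for x
  have g_add: "g (x + y) = g x + g y" if "x \<in> V" "y \<in> V" for x y
    using that by (simp add: g_def l(1) V_scale opscale_algebra complex_eq_iff)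
  have g_real: "g (r *\<^sub>R x) = of_real r * g x" if "x \<in> V" for x r
  proof -
    have "opscale \<i> (r *\<^sub>R x) = r *\<^sub>R opscale \<i> x"
      by (simp add: fun_eq_iff scaleR_conv_of_real)
    then show ?thesis using that by (simp add: g_def l(2) V_scale complex_eq_iff)
  qed
  have g_ii: "g (opscale \<i> x) = \<i> * g x" if "x \<in> V" for x
    using l(2)[OF that, of "-1"] by (simp add: g_def opscale_algebra complex_eq_iff)
  have g_scale: "g (opscale c x) = c * g x" if x: "x \<in> V" for c x
  proof -
    have "opscale c x = Re c *\<^sub>R x + Im c *\<^sub>R opscale \<i> x"
      by (simp add: fun_eq_iff scaleR_conv_of_real complex_eq_iff)
    then have "g (opscale c x) = of_real (Re c) * g x + of_real (Im c) * (\<i> * g x)"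
      using x V_scale[OF x] op_subspace_imp_subspace[OF V]
      by (simp add: g_add g_real g_ii subspace_scale)
    then show ?thesis by (simp add: complex_eq_iff)
  qed
  have "op_linear_on V g"
    by (simp add: op_linear_on_def g_add g_scale V_scale)
  moreover have "cmod (g x) \<le> q x" if x: "x \<in> V" for x
  proof -
    obtain b where b: "cmod b = 1" "b * g x = of_real (cmod (g x))" using ex_phase by blast
    then have "cmod (g x) = Re (g (opscale b x))" using g_scale[OF x] by simp
    also have "\<dots> \<le> q (opscale b x)" using l(3)[OF V_scale[OF x]] by (simp add: g_def)
    finally show ?thesis using q(2)[OF x] b by simp
  qed
  moreover have "g x = f x" if x: "x \<in> W" for x
    using l(4)[OF x] l(4)[OF op_subspace_scale[OF W(1) x, of \<i>]] W_scale[OF x, of \<i>]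
    by (simp add: g_def complex_eq_iff)
  ultimately show ?thesis using that by blast
qed

section \<open>Operators on l2\<close>

lemma vadd_eq_plus: "vadd x y = x + y"
  by (simp add: vadd_def fun_eq_iff)

lemma vscale_apply [simp]: "vscale c x i = c * x i"
  by (simp add: vscale_def)

lemma l2_iff: "x \<in> l2 \<longleftrightarrow> (\<lambda>i. (cmod (x i))\<^sup>2) summable_on UNIV"
  by (simp add: l2_def)

lemma l2_zero [simp]: "0 \<in> l2"
  by (simp add: l2_iff)

lemma l2_scale [simp]: "x \<in> l2 \<Longrightarrow> vscale c x \<in> l2"
  by (simp add: l2_iff norm_mult power_mult_distrib summable_on_cmult_right)

lemma l2_add [simp]:
  assumes "x \<in> l2" "y \<in> l2"
  shows "x + y \<in> l2"
proof -
  have "(cmod (x i + y i))\<^sup>2 \<le> 2 * (cmod (x i))\<^sup>2 + 2 * (cmod (y i))\<^sup>2" for i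
  proof -
    have "(cmod (x i + y i))\<^sup>2 \<le> (cmod (x i) + cmod (y i))\<^sup>2"
      by (intro power_mono norm_triangle_ineq) simp
    also have "\<dots> \<le> 2 * (cmod (x i))\<^sup>2 + 2 * (cmod (y i))\<^sup>2"
      using sum_squares_bound[of "cmod (x i)" "cmod (y i)"] by (simp add: power2_sum)
    finally show ?thesis .
  qed
  then show ?thesis
    using assms unfolding l2_iff
    by (auto intro!: summable_on_comparison_test[of "\<lambda>i. 2 * (cmod (x i))\<^sup>2 + 2 * (cmod (y i))\<^sup>2"]
        summable_on_add summable_on_cmult_right)
qed

lemma l2_diff [simp]: "x \<in> l2 \<Longrightarrow> y \<in> l2 \<Longrightarrow> x - y \<in> l2"
proof -
  assume "x \<in> l2" "y \<in> l2"
  then have "x + vscale (-1) y \<in> l2" by simp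
  also have "x + vscale (-1) y = x - y" by (simp add: fun_eq_iff)
  finally show ?thesis .
qed

lemma l2inner_summable:
  assumes "x \<in> l2" "y \<in> l2"
  shows "(\<lambda>i. cnj (x i) * y i) summable_on UNIV"
  by (rule abs_summable_summable, rule abs_summable_product)
    (use assms in \<open>simp_all add: l2_iff norm_mult power2_eq_square\<close>)

lemma l2inner_add_right:
  "x \<in> l2 \<Longrightarrow> y \<in> l2 \<Longrightarrow> z \<in> l2 \<Longrightarrow> l2inner x (y + z) = l2inner x y + l2inner x z"
  by (simp add: l2inner_def distrib_left infsum_add l2inner_summable)

lemma l2inner_scale_right: "l2inner x (vscale c y) = c * l2inner x y"
  by (simp add: l2inner_def mult.left_commute infsum_cmult_right')

lemma l2inner_commute: "l2inner x y = cnj (l2inner y x)"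
  by (simp add: l2inner_def mult.commute flip: infsum_cnj)

lemma l2inner_add_left:
  "x \<in> l2 \<Longrightarrow> y \<in> l2 \<Longrightarrow> z \<in> l2 \<Longrightarrow> l2inner (x + y) z = l2inner x z + l2inner y z"
  using l2inner_commute[of "x + y" z] l2inner_commute[of x z] l2inner_commute[of y z]
  by (simp add: l2inner_add_right)

lemma l2inner_scale_left: "l2inner (vscale c x) y = cnj c * l2inner x y"
  using l2inner_commute[of "vscale c x" y] l2inner_commute[of x y]
  by (simp add: l2inner_scale_right)

lemma l2inner_diff_left:
  assumes "x \<in> l2" "y \<in> l2" "z \<in> l2"
  shows "l2inner (x - y) z = l2inner x z - l2inner y z"
  using l2inner_add_left[of "x - y" y z] assms by simp

lemma l2norm_nonneg [simp]: "0 \<le> l2norm x"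
  by (simp add: l2norm_def infsum_nonneg)

lemma l2norm_square: "(l2norm x)\<^sup>2 = infsum (\<lambda>i. (cmod (x i))\<^sup>2) UNIV"
  by (simp add: l2norm_def infsum_nonneg)

lemma l2inner_self:
  assumes "x \<in> l2"
  shows "l2inner x x = of_real ((l2norm x)\<^sup>2)"
proof -
  have "((\<lambda>i. (cmod (x i))\<^sup>2) has_sum (l2norm x)\<^sup>2) UNIV"
    using assms by (simp add: l2_iff l2norm_square)
  then have "((\<lambda>i. of_real ((cmod (x i))\<^sup>2)) has_sum (of_real ((l2norm x)\<^sup>2) :: complex)) UNIV"
    by (simp only: has_sum_of_real_iff)
  also have "(\<lambda>i. of_real ((cmod (x i))\<^sup>2)) = (\<lambda>i. cnj (x i) * x i)"
    by (metis complex_norm_square mult.commute)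
  finally show ?thesis by (simp add: l2inner_def infsumI)
qed

lemma l2norm_scale: "l2norm (vscale c x) = cmod c * l2norm x"
  by (simp add: l2norm_def norm_mult power_mult_distrib infsum_cmult_right' real_sqrt_mult)

lemma l2norm_add_square:
  assumes "x \<in> l2" "y \<in> l2"
  shows "(l2norm (x + y))\<^sup>2 = (l2norm x)\<^sup>2 + (l2norm y)\<^sup>2 + 2 * Re (l2inner x y)"
proof -
  have "complex_of_real ((l2norm (x + y))\<^sup>2)
      = of_real ((l2norm x)\<^sup>2) + of_real ((l2norm y)\<^sup>2) + (l2inner x y + cnj (l2inner x y))"
    using assms l2inner_commute[of y x] l2inner_self[of "x + y"] l2inner_self[of x] l2inner_self[of y]
    by (simp add: l2inner_add_left l2inner_add_right algebra_simps del: of_real_power)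
  then show ?thesis
    by (simp add: complex_eq_iff)
qed

text \<open>The squared norm of x - t b y is nonnegative for every real t, where the phase b makes
  the inner product real. The claim is what this says about a quadratic in t.\<close>

lemma l2_cauchy_schwarz:
  assumes x: "x \<in> l2" and y: "y \<in> l2"
  shows "cmod (l2inner x y) \<le> l2norm x * l2norm y"
proof -
  let ?z = "cmod (l2inner x y)" and ?n = "l2norm x" and ?m = "l2norm y"
  obtain b where b: "cmod b = 1" "b * l2inner x y = of_real ?z" using ex_phase by blast
  have quad: "2 * t * ?z \<le> ?n\<^sup>2 + t\<^sup>2 * ?m\<^sup>2" for t :: real
  proof -
    have "0 \<le> (l2norm (x + vscale (of_real (-t) * b) y))\<^sup>2" by simp
    also have "\<dots> = ?n\<^sup>2 + t\<^sup>2 * ?m\<^sup>2 + 2 * Re (of_real (-t) * (b * l2inner x y))"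
      using x y b(1)
      by (simp only: l2norm_add_square[OF x l2_scale[OF y]] l2norm_scale l2inner_scale_right
          power_mult_distrib norm_mult mult.assoc) simp
    finally show ?thesis by (simp add: b(2))
  qed
  show ?thesis
  proof (cases "?m = 0")
    case True
    have "?z \<le> 0"
    proof (rule ccontr)
      assume z: "\<not> ?z \<le> 0"
      \<comment> \<open>When y has norm 0 the quadratic is linear in t; this t is large enough to
        violate it.\<close>
      have "2 * ((?n\<^sup>2 + 1) / ?z) * ?z \<le> ?n\<^sup>2" using quad[of "(?n\<^sup>2 + 1) / ?z"] True by simp
      then have "2 * (?n\<^sup>2 + 1) \<le> ?n\<^sup>2" using z by simp
      moreover have "0 \<le> ?n\<^sup>2" by simp
      ultimately show False by (simp only: distrib_left)
    qed
    then show ?thesis by simp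
  next
    case False
    then have m: "?m > 0" using l2norm_nonneg[of y] by linarith
    \<comment> \<open>The chosen t is the minimiser of the quadratic.\<close>
    have "2 * ?z\<^sup>2 / ?m\<^sup>2 \<le> ?n\<^sup>2 + ?z\<^sup>2 / ?m\<^sup>2"
      using quad[of "?z / ?m\<^sup>2"] m by (simp add: field_simps power2_eq_square)
    then have "?z\<^sup>2 \<le> (?n * ?m)\<^sup>2" using m by (simp add: field_simps)
    then show ?thesis by (rule power2_le_imp_le) simp
  qed
qed

lemma l2norm_triangle:
  assumes "x \<in> l2" "y \<in> l2"
  shows "l2norm (x + y) \<le> l2norm x + l2norm y"
proof (rule power2_le_imp_le)
  show "(l2norm (x + y))\<^sup>2 \<le> (l2norm x + l2norm y)\<^sup>2"
    using l2_cauchy_schwarz[OF assms] complex_Re_le_cmod[of "l2inner x y"]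
    unfolding l2norm_add_square[OF assms] power2_sum by linarith
qed simp

section \<open>Bounded operators and the operator norm\<close>

lemma BH_l2 [simp, intro]: "T \<in> BH \<Longrightarrow> x \<in> l2 \<Longrightarrow> T x \<in> l2"
  and BH_outside: "T \<in> BH \<Longrightarrow> x \<notin> l2 \<Longrightarrow> T x = 0"
  and BH_bounded: "T \<in> BH \<Longrightarrow> \<exists>K. \<forall>x\<in>l2. l2norm (T x) \<le> K * l2norm x"
  by (simp_all add: BH_def fun_eq_iff)

lemma BH_linear:
  "T \<in> BH \<Longrightarrow> x \<in> l2 \<Longrightarrow> y \<in> l2 \<Longrightarrow> T (vscale c x + y) = vscale c (T x) + T y"
  unfolding BH_def vadd_eq_plus by blast

lemma vscale_1 [simp]: "vscale 1 x = x" and vscale_zero [simp]: "vscale c 0 = 0"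
  by (simp_all add: fun_eq_iff)

lemma BH_add: "T \<in> BH \<Longrightarrow> x \<in> l2 \<Longrightarrow> y \<in> l2 \<Longrightarrow> T (x + y) = T x + T y"
  using BH_linear[of T x y 1] by simp

lemma BH_zero: "T \<in> BH \<Longrightarrow> T 0 = 0"
  using BH_add[of T 0 0] by simp

lemma BH_scale: "T \<in> BH \<Longrightarrow> x \<in> l2 \<Longrightarrow> T (vscale c x) = vscale c (T x)"
  using BH_linear[of T x 0 c] BH_zero[of T] by simp

lemma BH_diff:
  assumes "T \<in> BH" "x \<in> l2" "y \<in> l2"
  shows "T (x - y) = T x - T y"
  using BH_add[of T "x - y" y] assms by simp

lemma BH_I:
  assumes "\<And>x. x \<in> l2 \<Longrightarrow> T x \<in> l2"
    and "\<And>x y c. x \<in> l2 \<Longrightarrow> y \<in> l2 \<Longrightarrow> T (vscale c x + y) = vscale c (T x) + T y"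
    and "\<And>x. x \<in> l2 \<Longrightarrow> l2norm (T x) \<le> K * l2norm x"
    and "\<And>x. x \<notin> l2 \<Longrightarrow> T x = 0"
  shows "T \<in> BH"
  unfolding BH_def vadd_eq_plus zero_fun_def[symmetric] using assms by blast

lemma BH_0_if_norm_0:
  assumes T: "T \<in> BH" and x: "x \<in> l2" "l2norm x = 0"
  shows "l2norm (T x) = 0"
proof -
  obtain K where "l2norm (T x) \<le> K * l2norm x" using BH_bounded[OF T] x by blast
  then show ?thesis using l2norm_nonneg[of "T x"] x by simp
qed

lemma l2norm_apply_le:
  assumes T: "T \<in> BH" and x: "x \<in> l2"
  shows "l2norm (T x) \<le> opnorm T * l2norm x"
proof (cases "l2norm x = 0")
  case True
  then show ?thesis using BH_0_if_norm_0[OF T x] by simp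
next
  case False
  then have n: "l2norm x > 0" using l2norm_nonneg[of x] by linarith
  obtain K where K: "\<And>x. x \<in> l2 \<Longrightarrow> l2norm (T x) \<le> K * l2norm x" using BH_bounded[OF T] by blast
  have "bdd_above {l2norm (T x) | x. x \<in> l2 \<and> l2norm x \<le> 1}"
  proof (rule bdd_aboveI)
    fix r assume "r \<in> {l2norm (T x) | x. x \<in> l2 \<and> l2norm x \<le> 1}"
    then obtain u where "u \<in> l2" "l2norm u \<le> 1" "r = l2norm (T u)" by blast
    then have "r \<le> K * l2norm u" using K by blast
    also have "\<dots> \<le> \<bar>K\<bar> * 1" using \<open>l2norm u \<le> 1\<close> by (intro mult_mono) auto
    finally show "r \<le> \<bar>K\<bar>" by simp
  qed
  moreover define u where "u = vscale (of_real (1 / l2norm x)) x"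
  then have u: "u \<in> l2" "l2norm u = 1" using x n by (simp_all add: l2norm_scale norm_divide)
  ultimately have "l2norm (T u) \<le> opnorm T"
    unfolding opnorm_def by (intro cSup_upper) auto
  also have "l2norm (T u) = l2norm (T x) / l2norm x"
    using x n by (simp add: u_def BH_scale[OF T] l2norm_scale norm_divide)
  finally show ?thesis using n by (simp add: field_simps)
qed

lemma opnorm_le:
  assumes "C \<ge> 0" "\<And>x. x \<in> l2 \<Longrightarrow> l2norm (T x) \<le> C * l2norm x"
  shows "opnorm T \<le> C"
  unfolding opnorm_def
proof (rule cSup_least)
  have "l2norm (0::'a vec) \<le> 1" by (simp add: l2norm_def)
  then show "{l2norm (T x) | x. x \<in> l2 \<and> l2norm x \<le> 1} \<noteq> {}" using l2_zero by blast
  fix r assume "r \<in> {l2norm (T x) | x. x \<in> l2 \<and> l2norm x \<le> 1}"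
  then obtain u where "u \<in> l2" "l2norm u \<le> 1" "r = l2norm (T u)" by blast
  then show "r \<le> C" using assms(2)[of u] mult_left_mono[of "l2norm u" 1 C] assms(1) by simp
qed

lemma opnorm_nonneg [simp]:
  assumes "T \<in> BH" shows "0 \<le> opnorm T"
proof (cases "\<exists>x\<in>l2. l2norm (x::'a vec) \<noteq> 0")
  case True
  then obtain x :: "'a vec" where x: "x \<in> l2" "l2norm x \<noteq> 0" by blast
  then have "0 < l2norm x" using l2norm_nonneg[of x] by linarith
  moreover have "0 \<le> opnorm T * l2norm x"
    using l2norm_apply_le[OF assms x(1)] l2norm_nonneg[of "T x"] by linarith
  ultimately show ?thesis by (simp add: zero_le_mult_iff)
next
  case False
  then have "l2norm (T x) = 0" if "x \<in> l2" for x using BH_l2[OF assms that] by blast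
  moreover have "(0 :: 'a vec) \<in> l2" "l2norm (0 :: 'a vec) \<le> 1" using False by simp_all
  ultimately have "{l2norm (T x) | x. x \<in> l2 \<and> l2norm x \<le> 1} = {0}"
    by (auto intro!: exI[of _ 0])
  then show ?thesis by (simp add: opnorm_def)
qed

lemma BH_plus [simp]:
  assumes S: "S \<in> BH" and T: "T \<in> BH"
  shows "S + T \<in> BH"
    and opnorm_triangle: "opnorm (S + T) \<le> opnorm S + opnorm T"
proof -
  have *: "l2norm ((S + T) x) \<le> (opnorm S + opnorm T) * l2norm x" if x: "x \<in> l2" for x
    using l2norm_triangle[of "S x" "T x"] l2norm_apply_le[OF S x] l2norm_apply_le[OF T x] S T x
    by (simp add: distrib_right)
  show "S + T \<in> BH"
    by (rule BH_I[OF _ _ *])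
      (use S T in \<open>auto simp: BH_add[OF S] BH_add[OF T] BH_scale[OF S] BH_scale[OF T]
        BH_outside[OF S] BH_outside[OF T] fun_eq_iff algebra_simps\<close>)
  show "opnorm (S + T) \<le> opnorm S + opnorm T"
    using S T by (intro opnorm_le *) auto
qed

lemma BH_opscale [simp]:
  assumes S: "S \<in> BH"
  shows "opscale c S \<in> BH"
    and opnorm_opscale: "opnorm (opscale c S) = cmod c * opnorm S"
proof -
  have eq: "opscale c S x = vscale c (S x)" for c x by (simp add: fun_eq_iff)
  have *: "l2norm (opscale c S x) \<le> (cmod c * opnorm S) * l2norm x" if x: "x \<in> l2" for c x
    using mult_left_mono[OF l2norm_apply_le[OF S x], of "cmod c"]
    by (simp add: eq l2norm_scale mult.assoc)
  have in_BH: "opscale c S \<in> BH" for c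
    by (rule BH_I[OF _ _ *])
      (use S in \<open>auto simp: BH_add[OF S] BH_scale[OF S] BH_outside[OF S] fun_eq_iff algebra_simps eq\<close>)
  show "opscale c S \<in> BH" by (rule in_BH)
  have le: "opnorm (opscale c S) \<le> cmod c * opnorm S" for c
    using S by (intro opnorm_le *) auto
  show "opnorm (opscale c S) = cmod c * opnorm S"
  proof (cases "c = 0")
    case True
    then show ?thesis using le[of c] opnorm_nonneg[OF in_BH[of c]] by simp
  next
    case False
    have "opnorm S \<le> opnorm (opscale c S) / cmod c"
    proof (rule opnorm_le)
      fix x :: "'a vec" assume x: "x \<in> l2"
      then show "l2norm (S x) \<le> opnorm (opscale c S) / cmod c * l2norm x"
        using l2norm_apply_le[OF in_BH x, of c] False
        by (simp add: eq l2norm_scale field_simps)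
    qed (use in_BH in simp)
    then show ?thesis using le[of c] False by (simp add: field_simps)
  qed
qed

lemma BH_zero_op [simp]: "(0::'i op) \<in> BH"
  by (rule BH_I[of _ 0]) (auto simp: l2norm_def)

lemma op_subspace_BH: "op_subspace BH"
  by (simp add: op_subspace_def)

lemma BH_minus [simp]: "S \<in> BH \<Longrightarrow> T \<in> BH \<Longrightarrow> S - T \<in> BH"
  by (rule op_subspace_diff[OF op_subspace_BH])

lemma opnorm_zero [simp]: "opnorm (0::'i op) = 0"
  using opnorm_opscale[OF BH_zero_op, of 0] by (simp add: opscale_algebra)

lemma opnorm_minus_le: "S \<in> BH \<Longrightarrow> T \<in> BH \<Longrightarrow> opnorm (S - T) \<le> opnorm S + opnorm T"
  using opnorm_triangle[of S "opscale (-1) T"] opnorm_opscale[of T "-1"]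
  by (simp add: opscale_algebra BH_opscale(1)[of T "-1", unfolded opscale_algebra])

lemma opmult_apply [simp]: "opmult S T x = S (T x)"
  by (simp add: opmult_def)

lemma BH_opmult [simp]:
  assumes S: "S \<in> BH" and T: "T \<in> BH"
  shows "opmult S T \<in> BH"
    and opnorm_opmult_le: "opnorm (opmult S T) \<le> opnorm S * opnorm T"
proof -
  have *: "l2norm (opmult S T x) \<le> (opnorm S * opnorm T) * l2norm x" if x: "x \<in> l2" for x
  proof -
    have "l2norm (opmult S T x) \<le> opnorm S * l2norm (T x)"
      using l2norm_apply_le[OF S, of "T x"] T x by simp
    also have "\<dots> \<le> opnorm S * (opnorm T * l2norm x)"
      by (intro mult_left_mono l2norm_apply_le T x opnorm_nonneg S)
    finally show ?thesis by (simp add: mult.assoc)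
  qed
  show "opmult S T \<in> BH"
    by (rule BH_I[OF _ _ *])
      (use S T in \<open>auto simp: BH_linear[OF S] BH_linear[OF T] BH_outside[OF T] BH_zero[OF S]\<close>)
  show "opnorm (opmult S T) \<le> opnorm S * opnorm T"
    using S T by (intro opnorm_le *) auto
qed

lemma opmult_assoc: "opmult (opmult R S) T = opmult R (opmult S T)"
  by (simp add: opmult_def comp_assoc)

lemma opmult_plus_left: "opmult (R + S) T = opmult R T + opmult S T"
  and opmult_minus_left: "opmult (R - S) T = opmult R T - opmult S T"
  and opmult_opscale_left: "opmult (opscale c S) T = opscale c (opmult S T)"
  by (auto simp: fun_eq_iff)

lemma opmult_plus_right:
    "T \<in> BH \<Longrightarrow> R \<in> BH \<Longrightarrow> S \<in> BH \<Longrightarrow> opmult T (R + S) = opmult T R + opmult T S"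
  and opmult_minus_right:
    "T \<in> BH \<Longrightarrow> R \<in> BH \<Longrightarrow> S \<in> BH \<Longrightarrow> opmult T (R - S) = opmult T R - opmult T S"
  and opmult_opscale_right:
    "T \<in> BH \<Longrightarrow> S \<in> BH \<Longrightarrow> opmult T (opscale c S) = opscale c (opmult T S)"
proof -
  \<comment> \<open>Elements of \<open>BH\<close> are 0 outside \<open>l2\<close> by convention, so
    their values lie in \<open>l2\<close> at every argument. This allows linearity of
    \<open>T\<close> to be used in an equality of functions on all vectors.\<close>
  have in_l2: "R x \<in> l2" if "R \<in> BH" for R :: "'a op" and x
    using BH_l2[OF that, of x] BH_outside[OF that, of x] l2_zero by metis
  show "opmult T (R + S) = opmult T R + opmult T S" "opmult T (R - S) = opmult T R - opmult T S"
    if T: "T \<in> BH" and R: "R \<in> BH" and S: "S \<in> BH"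
    using in_l2[OF R] in_l2[OF S] by (simp_all add: fun_eq_iff BH_add[OF T] BH_diff[OF T])
  have eq: "opscale c S x = vscale c (S x)" for x by (simp add: fun_eq_iff)
  show "opmult T (opscale c S) = opscale c (opmult T S)" if T: "T \<in> BH" and S: "S \<in> BH"
    using in_l2[OF S] by (simp add: fun_eq_iff BH_scale[OF T] eq)
qed

section \<open>Finite truncations and the adjoint\<close>

definition unit_vec :: "'i \<Rightarrow> 'i vec" where
  "unit_vec i = (\<lambda>j. if j = i then 1 else 0)"

definition truncate :: "'i set \<Rightarrow> 'i vec \<Rightarrow> 'i vec" where
  "truncate F x = (\<lambda>i. if i \<in> F then x i else 0)"

lemma truncate_square:
  assumes "finite F"
  shows "((\<lambda>i. (cmod (truncate F x i))\<^sup>2) has_sum (\<Sum>i\<in>F. (cmod (x i))\<^sup>2)) UNIV"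
proof -
  have "((\<lambda>i. (cmod (x i))\<^sup>2) has_sum (\<Sum>i\<in>F. (cmod (x i))\<^sup>2)) F"
    using assms by simp
  then show ?thesis
    by (rule has_sum_cong_neutral[THEN iffD1, rotated -1]) (auto simp: truncate_def)
qed

lemma truncate_l2 [simp]: "finite F \<Longrightarrow> truncate F x \<in> l2"
  using truncate_square[of F x] by (auto simp: l2_iff summable_on_def)

lemma l2norm_truncate: "finite F \<Longrightarrow> (l2norm (truncate F x))\<^sup>2 = (\<Sum>i\<in>F. (cmod (x i))\<^sup>2)"
  using truncate_square[of F x] by (simp add: l2norm_square infsumI)

lemma unit_vec_l2 [simp]: "unit_vec i \<in> l2"
proof -
  have "unit_vec i = truncate {i} (\<lambda>_. 1)" by (auto simp: unit_vec_def truncate_def)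
  then show ?thesis by simp
qed

lemma l2inner_unit_vec: "l2inner (unit_vec i) y = y i"
proof -
  have "l2inner (unit_vec i) y = infsum (\<lambda>j. y j) {i}"
    unfolding l2inner_def by (rule infsum_cong_neutral) (auto simp: unit_vec_def)
  then show ?thesis by simp
qed

lemma l2norm_truncate_tail:
  assumes F: "finite F" and x: "x \<in> l2"
  shows "(l2norm (x - truncate F x))\<^sup>2 = (l2norm x)\<^sup>2 - (\<Sum>i\<in>F. (cmod (x i))\<^sup>2)"
proof -
  have "infsum (\<lambda>i. (cmod (x i))\<^sup>2) UNIV
      = infsum (\<lambda>i. (cmod (truncate F x i))\<^sup>2 + (cmod ((x - truncate F x) i))\<^sup>2) UNIV"
    by (rule infsum_cong) (simp add: truncate_def)
  also have "\<dots> = (l2norm (truncate F x))\<^sup>2 + (l2norm (x - truncate F x))\<^sup>2"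
    unfolding l2norm_square
    by (rule infsum_add) (use l2_diff[OF x truncate_l2[OF F]] truncate_l2[OF F] in \<open>auto simp: l2_iff\<close>)
  finally show ?thesis using l2norm_truncate[OF F, of x] by (simp add: l2norm_square)
qed

lemma truncate_tendsto:
  assumes x: "x \<in> l2"
  shows "((\<lambda>F. l2norm (x - truncate F x)) \<longlongrightarrow> 0) (finite_subsets_at_top UNIV)"
proof -
  have "((\<lambda>F. \<Sum>i\<in>F. (cmod (x i))\<^sup>2) \<longlongrightarrow> (l2norm x)\<^sup>2) (finite_subsets_at_top UNIV)"
    using infsum_tendsto[of "\<lambda>i. (cmod (x i))\<^sup>2" UNIV] x by (simp add: l2_iff l2norm_square)
  then have "((\<lambda>F. sqrt ((l2norm x)\<^sup>2 - (\<Sum>i\<in>F. (cmod (x i))\<^sup>2)))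
      \<longlongrightarrow> sqrt ((l2norm x)\<^sup>2 - (l2norm x)\<^sup>2)) (finite_subsets_at_top UNIV)"
    by (intro tendsto_intros)
  moreover have "\<forall>\<^sub>F F in finite_subsets_at_top UNIV.
      sqrt ((l2norm x)\<^sup>2 - (\<Sum>i\<in>F. (cmod (x i))\<^sup>2)) = l2norm (x - truncate F x)"
    by (rule eventually_finite_subsets_at_top_weakI)
      (simp flip: l2norm_truncate_tail[OF _ x])
  ultimately show ?thesis
    using tendsto_cong by fastforce
qed

lemma l2inner_apply_truncate:
  assumes T: "T \<in> BH" and y: "y \<in> l2" and F: "finite F"
  shows "l2inner (T (truncate F x)) y = (\<Sum>i\<in>F. cnj (x i) * l2inner (T (unit_vec i)) y)"
  using F
proof (induction F)
  case empty
  have "truncate {} x = 0" by (simp add: truncate_def fun_eq_iff)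
  moreover have "l2inner 0 y = 0" by (simp add: l2inner_def)
  ultimately show ?case using BH_zero[OF T] by (simp only: sum.empty)
next
  case (insert i F)
  have "truncate (insert i F) x = vscale (x i) (unit_vec i) + truncate F x"
    using insert by (auto simp: truncate_def unit_vec_def fun_eq_iff)
  then have "T (truncate (insert i F) x) = vscale (x i) (T (unit_vec i)) + T (truncate F x)"
    using BH_linear[OF T unit_vec_l2 truncate_l2[OF insert.hyps(1)]] by (simp only:)
  then have "l2inner (T (truncate (insert i F) x)) y
      = cnj (x i) * l2inner (T (unit_vec i)) y + l2inner (T (truncate F x)) y"
    using insert.hyps(1) T y by (simp only: l2inner_add_left l2inner_scale_left BH_l2 l2_scale
        unit_vec_l2 truncate_l2)
  then show ?case using insert by simp
qed

text \<open>Pairing with unit vectors forces coordinate i of \<open>S y\<close> to be the inner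
  product of \<open>T (unit_vec i)\<close> with \<open>y\<close>. On truncations of x the adjoint
  identity is then a finite sum, and continuity of both sides carries it over to x.\<close>

lemma adjoint_exists:
  assumes T: "T \<in> BH"
  shows "\<exists>S\<in>BH. \<forall>x\<in>l2. \<forall>y\<in>l2. l2inner (T x) y = l2inner x (S y)"
proof -
  define S where "S y = (if y \<in> l2 then (\<lambda>i. l2inner (T (unit_vec i)) y) else 0)" for y
  have S_partial: "(\<Sum>i\<in>F. (cmod (S y i))\<^sup>2) \<le> (opnorm T * l2norm y)\<^sup>2"
    if y: "y \<in> l2" and F: "finite F" for y F
  proof -
    \<comment> \<open>Testing \<open>T\<close> on the truncation of \<open>S y\<close> itself gives
      n^2 \<le> \<open>opnorm T * n * l2norm y\<close>, and one factor n cancels.\<close>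
    define n where "n = l2norm (truncate F (S y))"
    have "complex_of_real (n\<^sup>2) = (\<Sum>i\<in>F. of_real ((cmod (S y i))\<^sup>2))"
      unfolding n_def l2norm_truncate[OF F] of_real_sum ..
    also have "\<dots> = (\<Sum>i\<in>F. cnj (S y i) * l2inner (T (unit_vec i)) y)"
      using y by (intro sum.cong refl) (simp add: S_def complex_norm_square mult.commute flip: of_real_power)
    also have "\<dots> = l2inner (T (truncate F (S y))) y"
      by (simp add: l2inner_apply_truncate[OF T y F])
    finally have "n\<^sup>2 = cmod (l2inner (T (truncate F (S y))) y)"
      by (metis abs_of_nonneg norm_of_real zero_le_power2)
    also have "\<dots> \<le> l2norm (T (truncate F (S y))) * l2norm y"
      using T y F by (intro l2_cauchy_schwarz) auto
    also have "\<dots> \<le> opnorm T * n * l2norm y"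
      unfolding n_def using T F by (intro mult_right_mono l2norm_apply_le) auto
    finally have "n * n \<le> (opnorm T * l2norm y) * n" by (simp add: power2_eq_square algebra_simps)
    moreover have "n \<ge> 0" "0 \<le> opnorm T * l2norm y" using T by (simp_all add: n_def)
    ultimately have "n \<le> opnorm T * l2norm y"
      by (cases "n = 0") (auto simp: mult_le_cancel_right)
    then have "n\<^sup>2 \<le> (opnorm T * l2norm y)\<^sup>2" using \<open>n \<ge> 0\<close> by (intro power_mono)
    then show ?thesis by (simp add: n_def l2norm_truncate[OF F])
  qed
  have S_l2: "S y \<in> l2" if y: "y \<in> l2" for y
    unfolding l2_iff
    by (rule nonneg_bdd_above_summable_on)
      (auto intro!: bdd_aboveI2[of _ _ "(opnorm T * l2norm y)\<^sup>2"] S_partial[OF y])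
  have adj: "l2inner (T x) y = l2inner x (S y)" if x: "x \<in> l2" and y: "y \<in> l2" for x y
  proof (rule tendsto_unique)
    let ?FF = "finite_subsets_at_top (UNIV :: 'a set)"
    show "?FF \<noteq> bot" by simp
    have "((\<lambda>F. \<Sum>i\<in>F. cnj (x i) * S y i) \<longlongrightarrow> l2inner x (S y)) ?FF"
      using infsum_tendsto[OF l2inner_summable[OF x S_l2[OF y]]] by (simp add: l2inner_def)
    moreover have "\<forall>\<^sub>F F in ?FF. (\<Sum>i\<in>F. cnj (x i) * S y i) = l2inner (T (truncate F x)) y"
      by (rule eventually_finite_subsets_at_top_weakI)
        (use y in \<open>simp add: l2inner_apply_truncate[OF T y] S_def\<close>)
    ultimately show "((\<lambda>F. l2inner (T (truncate F x)) y) \<longlongrightarrow> l2inner x (S y)) ?FF"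
      using tendsto_cong by fastforce
    have "((\<lambda>F. opnorm T * l2norm (x - truncate F x) * l2norm y) \<longlongrightarrow> opnorm T * 0 * l2norm y) ?FF"
      by (intro tendsto_intros truncate_tendsto[OF x])
    then have "((\<lambda>F. opnorm T * l2norm (x - truncate F x) * l2norm y) \<longlongrightarrow> 0) ?FF" by simp
    moreover have "\<forall>\<^sub>F F in ?FF. norm (l2inner (T (truncate F x)) y - l2inner (T x) y)
        \<le> opnorm T * l2norm (x - truncate F x) * l2norm y"
    proof (rule eventually_finite_subsets_at_top_weakI)
      fix F :: "'a set" assume F: "finite F"
      have "l2inner (T x) y - l2inner (T (truncate F x)) y = l2inner (T (x - truncate F x)) y"
        using x y T F by (simp add: BH_diff[OF T] l2inner_diff_left BH_l2[OF T])
      then have "norm (l2inner (T (truncate F x)) y - l2inner (T x) y)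
          \<le> l2norm (T (x - truncate F x)) * l2norm y"
        using l2_cauchy_schwarz[of "T (x - truncate F x)" y] x y T F
        by (simp add: norm_minus_commute)
      also have "\<dots> \<le> opnorm T * l2norm (x - truncate F x) * l2norm y"
        by (intro mult_right_mono l2norm_apply_le[OF T] l2_diff[OF x] truncate_l2[OF F] l2norm_nonneg)
      finally show "norm (l2inner (T (truncate F x)) y - l2inner (T x) y)
          \<le> opnorm T * l2norm (x - truncate F x) * l2norm y" .
    qed
    ultimately have "((\<lambda>F. l2inner (T (truncate F x)) y - l2inner (T x) y) \<longlongrightarrow> 0) ?FF"
      by (rule Lim_null_comparison[rotated])
    then show "((\<lambda>F. l2inner (T (truncate F x)) y) \<longlongrightarrow> l2inner (T x) y) ?FF"
      by (simp add: LIM_zero_iff)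
  qed
  have "S \<in> BH"
  proof (rule BH_I[OF S_l2])
    show "S (vscale c x + y) = vscale c (S x) + S y" if "x \<in> l2" "y \<in> l2" for x y c
      using that T
      by (simp add: S_def fun_eq_iff l2inner_add_right l2inner_scale_right BH_l2[OF T])
    show "l2norm (S y) \<le> opnorm T * l2norm y" if y: "y \<in> l2" for y
    proof (rule power2_le_imp_le)
      show "(l2norm (S y))\<^sup>2 \<le> (opnorm T * l2norm y)\<^sup>2"
        unfolding l2norm_square
        by (rule infsum_le_finite_sums) (use S_l2[OF y] S_partial[OF y] in \<open>auto simp: l2_iff\<close>)
      show "0 \<le> opnorm T * l2norm y" using T by simp
    qed
    show "S y = 0" if "y \<notin> l2" for y unfolding S_def if_not_P[OF that] ..
  qed
  then show ?thesis using adj by blast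
qed

text \<open>Unit vectors read off every coordinate at arguments in \<open>l2\<close>, and elsewhere
  both operators are 0. This gives meaning to the definite description in
  \<open>opadj\<close>.\<close>

lemma adjoint_unique:
  assumes "S \<in> BH" "S' \<in> BH"
    and "\<And>x y. x \<in> l2 \<Longrightarrow> y \<in> l2 \<Longrightarrow> l2inner x (S y) = l2inner x (S' y)"
  shows "S = S'"
proof
  fix y show "S y = S' y"
  proof (cases "y \<in> l2")
    case True
    then show ?thesis using assms(3)[OF unit_vec_l2] by (simp add: l2inner_unit_vec fun_eq_iff)
  qed (use BH_outside[OF assms(1)] BH_outside[OF assms(2)] in simp)
qed

lemma opadj_char:
  assumes "T \<in> BH"
  shows "opadj T \<in> BH \<and> (\<forall>x\<in>l2. \<forall>y\<in>l2. l2inner (T x) y = l2inner x (opadj T y))"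
  unfolding opadj_def
proof (rule theI'[of "\<lambda>S. S \<in> BH \<and> (\<forall>x\<in>l2. \<forall>y\<in>l2. l2inner (T x) y = l2inner x (S y))"])
  obtain S where S: "S \<in> BH" "\<forall>x\<in>l2. \<forall>y\<in>l2. l2inner (T x) y = l2inner x (S y)"
    using adjoint_exists[OF assms] by blast
  show "\<exists>!S. S \<in> BH \<and> (\<forall>x\<in>l2. \<forall>y\<in>l2. l2inner (T x) y = l2inner x (S y))"
    by (rule ex1I[of _ S]) (use S in \<open>auto intro!: adjoint_unique\<close>)
qed

lemma opadj_BH [simp]: "T \<in> BH \<Longrightarrow> opadj T \<in> BH"
  and opadj_inner: "T \<in> BH \<Longrightarrow> x \<in> l2 \<Longrightarrow> y \<in> l2 \<Longrightarrow> l2inner x (opadj T y) = l2inner (T x) y"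
  using opadj_char[of T] by auto

lemma opadj_eqI:
  assumes "T \<in> BH" "S \<in> BH" "\<And>x y. x \<in> l2 \<Longrightarrow> y \<in> l2 \<Longrightarrow> l2inner x (S y) = l2inner (T x) y"
  shows "opadj T = S"
  by (rule adjoint_unique) (use assms opadj_inner in auto)

lemma opadj_opadj [simp]:
  assumes T: "T \<in> BH" shows "opadj (opadj T) = T"
proof (rule opadj_eqI)
  fix x y :: "'a vec" assume "x \<in> l2" "y \<in> l2"
  then show "l2inner x (T y) = l2inner (opadj T x) y"
    using opadj_inner[OF T, of y x] l2inner_commute[of x "T y"] l2inner_commute[of "opadj T x" y]
    by simp
qed (use T in auto)

lemma opadj_opmult:
  assumes S: "S \<in> BH" and T: "T \<in> BH"
  shows "opadj (opmult S T) = opmult (opadj T) (opadj S)"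
  by (rule opadj_eqI) (use S T in \<open>simp_all add: opadj_inner\<close>)

lemma opadj_plus:
  assumes S: "S \<in> BH" and T: "T \<in> BH"
  shows "opadj (S + T) = opadj S + opadj T"
  by (rule opadj_eqI) (use S T in \<open>simp_all add: opadj_inner l2inner_add_right l2inner_add_left\<close>)

lemma opadj_opscale:
  assumes S: "S \<in> BH"
  shows "opadj (opscale c S) = opscale (cnj c) (opadj S)"
proof (rule opadj_eqI)
  fix x y :: "'a vec" assume xy: "x \<in> l2" "y \<in> l2"
  have "opscale c S x = vscale c (S x)" "opscale (cnj c) (opadj S) y = vscale (cnj c) (opadj S y)"
    by (simp_all add: fun_eq_iff)
  then show "l2inner x (opscale (cnj c) (opadj S) y) = l2inner (opscale c S x) y"
    using opadj_inner[OF S xy] by (simp add: l2inner_scale_right l2inner_scale_left)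
qed (use S in auto)

text \<open>The squared norm of S^* y is the inner product of S S^* y with y, so Cauchy-Schwarz
  gives one inequality; applied to S^*, it gives the other.\<close>

lemma opnorm_opadj [simp]:
  assumes "T \<in> BH" shows "opnorm (opadj T) = opnorm T"
proof -
  have le: "opnorm (opadj S) \<le> opnorm S" if S: "S \<in> BH" for S :: "'a op"
  proof (rule opnorm_le)
    fix y :: "'a vec" assume y: "y \<in> l2"
    let ?n = "l2norm (opadj S y)"
    have y': "opadj S y \<in> l2" using S y by simp
    have "complex_of_real (?n\<^sup>2) = l2inner (S (opadj S y)) y"
      using opadj_inner[OF S y' y] l2inner_self[OF y'] by simp
    then have "?n\<^sup>2 = cmod (l2inner (S (opadj S y)) y)"
      by (metis abs_of_nonneg norm_of_real zero_le_power2)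
    also have "\<dots> \<le> l2norm (S (opadj S y)) * l2norm y"
      using S y y' by (intro l2_cauchy_schwarz) auto
    also have "\<dots> \<le> opnorm S * ?n * l2norm y"
      using S y' by (intro mult_right_mono l2norm_apply_le) auto
    finally have "?n * ?n \<le> (opnorm S * l2norm y) * ?n"
      by (simp add: power2_eq_square algebra_simps)
    moreover have "?n \<ge> 0" "0 \<le> opnorm S * l2norm y" using S by simp_all
    ultimately show "?n \<le> opnorm S * l2norm y"
      by (cases "?n = 0") (auto simp: mult_le_cancel_right)
  qed (use S in simp)
  show ?thesis using le[OF assms] le[OF opadj_BH[OF assms]] assms by simp
qed

text \<open>The cross term of |(S + T) v|^2 is the inner product of S v with T v, that is, of v with
  S^* T v. When S^* T is negligible, adding T to S affects the norm only to second order in T; the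
  uniqueness proof rests on this gain.\<close>

lemma opnorm_add_square_le:
  assumes S: "S \<in> BH" and T: "T \<in> BH"
  shows "(opnorm (S + T))\<^sup>2 \<le> (opnorm S)\<^sup>2 + (opnorm T)\<^sup>2 + 2 * opnorm (opmult (opadj S) T)"
proof -
  define C where "C = (opnorm S)\<^sup>2 + (opnorm T)\<^sup>2 + 2 * opnorm (opmult (opadj S) T)"
  have C: "C \<ge> 0" using S T by (simp add: C_def)
  have "opnorm (S + T) \<le> sqrt C"
  proof (rule opnorm_le)
    fix v :: "'a vec" assume v: "v \<in> l2"
    have "Re (l2inner (S v) (T v)) \<le> cmod (l2inner v (opmult (opadj S) T v))"
      using opadj_inner[OF S v BH_l2[OF T v]] by (simp add: complex_Re_le_cmod)
    also have "\<dots> \<le> l2norm v * l2norm (opmult (opadj S) T v)"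
      using S T v by (intro l2_cauchy_schwarz) auto
    also have "\<dots> \<le> l2norm v * (opnorm (opmult (opadj S) T) * l2norm v)"
      by (intro mult_left_mono l2norm_apply_le[OF BH_opmult(1)[OF opadj_BH[OF S] T] v] l2norm_nonneg)
    finally have cross: "Re (l2inner (S v) (T v)) \<le> opnorm (opmult (opadj S) T) * (l2norm v)\<^sup>2"
      by (simp add: power2_eq_square algebra_simps)
    have sq: "(l2norm (R v))\<^sup>2 \<le> (opnorm R)\<^sup>2 * (l2norm v)\<^sup>2" if "R \<in> BH" for R :: "'a op"
      using power_mono[OF l2norm_apply_le[OF that v], of 2] by (simp add: power_mult_distrib)
    have "(l2norm ((S + T) v))\<^sup>2 = (l2norm (S v))\<^sup>2 + (l2norm (T v))\<^sup>2 + 2 * Re (l2inner (S v) (T v))"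
      using S T v by (simp add: l2norm_add_square BH_l2[OF S] BH_l2[OF T])
    also have "\<dots> \<le> C * (l2norm v)\<^sup>2"
      using sq[OF S] sq[OF T] cross by (simp add: C_def algebra_simps)
    also have "\<dots> = (sqrt C * l2norm v)\<^sup>2" using C by (simp add: power_mult_distrib)
    finally show "l2norm ((S + T) v) \<le> sqrt C * l2norm v"
      by (rule power2_le_imp_le) (use C in simp)
  qed (use C in simp)
  then have "(opnorm (S + T))\<^sup>2 \<le> (sqrt C)\<^sup>2"
    using S T by (intro power_mono) auto
  then show ?thesis using C by (simp add: C_def)
qed

section \<open>The Arens product and hereditary subalgebras\<close>

lemma subalgebra_BH_iff:
  "subalgebra_BH X \<longleftrightarrow> op_subspace X \<and> X \<subseteq> BH \<and> (\<forall>a\<in>X. \<forall>b\<in>X. opmult a b \<in> X)"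
  unfolding subalgebra_BH_def op_subspace_def opadd_eq_plus zero_op by blast

lemma subalgebra_BH_subspace: "subalgebra_BH X \<Longrightarrow> op_subspace X"
  and subalgebra_BH_in_BH: "subalgebra_BH X \<Longrightarrow> a \<in> X \<Longrightarrow> a \<in> BH"
  and subalgebra_BH_mult: "subalgebra_BH X \<Longrightarrow> a \<in> X \<Longrightarrow> b \<in> X \<Longrightarrow> opmult a b \<in> X"
  by (auto simp: subalgebra_BH_iff)

lemma subalgebra_BH_BH: "subalgebra_BH BH"
  by (simp add: subalgebra_BH_iff op_subspace_BH)

section \<open>Norms on the dual and the bidual\<close>

lemma dual_iff: "\<phi> \<in> dual X \<longleftrightarrow> op_linear_on X \<phi>
    \<and> (\<exists>K. \<forall>a\<in>X. cmod (\<phi> a) \<le> K * opnorm a) \<and> (\<forall>a. a \<notin> X \<longrightarrow> \<phi> a = 0)"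
  unfolding dual_def op_linear_on_def opadd_eq_plus by blast

lemma dual_linear: "\<phi> \<in> dual X \<Longrightarrow> op_linear_on X \<phi>"
  by (simp add: dual_iff)

text \<open>Elements of \<open>dual\<close> vanish off the subspace, so that equal functionals are
  equal functions. Functionals constructed on a subspace are therefore cut off in this way.\<close>

lemma dual_restrictI:
  assumes V: "op_subspace V" and lin: "op_linear_on V g"
    and bound: "\<And>a. a \<in> V \<Longrightarrow> cmod (g a) \<le> K * opnorm a"
  shows "(\<lambda>a. if a \<in> V then g a else 0) \<in> dual V"
  using assms unfolding dual_iff op_linear_on_def
  by (auto simp: op_subspace_add op_subspace_scale intro: exI[of _ K])

lemma fnorm_bound:
  assumes V: "op_subspace V" "V \<subseteq> BH" and \<phi>: "\<phi> \<in> dual V" and a: "a \<in> V"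
  shows "cmod (\<phi> a) \<le> fnorm V \<phi> * opnorm a"
proof -
  obtain K where K: "\<And>a. a \<in> V \<Longrightarrow> cmod (\<phi> a) \<le> K * opnorm a" using \<phi> by (auto simp: dual_iff)
  show ?thesis
  proof (cases "opnorm a = 0")
    case True
    then show ?thesis using K[OF a] by simp
  next
    case False
    then have n: "opnorm a > 0" using opnorm_nonneg[of a] a V(2) by fastforce
    define u where "u = opscale (of_real (1 / opnorm a)) a"
    have u: "u \<in> V" "opnorm u = 1"
      using a V n by (auto simp: u_def op_subspace_scale opnorm_opscale norm_divide subset_iff)
    have "bdd_above {cmod (\<phi> a) | a. a \<in> V \<and> opnorm a \<le> 1}"
    proof (rule bdd_aboveI)
      fix r assume "r \<in> {cmod (\<phi> a) | a. a \<in> V \<and> opnorm a \<le> 1}"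
      then obtain b where b: "b \<in> V" "opnorm b \<le> 1" "r = cmod (\<phi> b)" by blast
      then have "r \<le> K * opnorm b" using K by blast
      also have "\<dots> \<le> \<bar>K\<bar> * 1" using b V by (intro mult_mono) (auto intro: opnorm_nonneg)
      finally show "r \<le> \<bar>K\<bar>" by simp
    qed
    then have "cmod (\<phi> u) \<le> fnorm V \<phi>"
      unfolding fnorm_def using u by (intro cSup_upper) auto
    also have "cmod (\<phi> u) = cmod (\<phi> a) / opnorm a"
      using op_linear_on_scale[OF V(1) dual_linear[OF \<phi>] a] n
      by (simp add: u_def norm_mult norm_divide)
    finally show ?thesis using n by (simp add: field_simps)
  qed
qed

lemma fnorm_le:
  assumes V: "op_subspace V" and "C \<ge> 0" "\<And>a. a \<in> V \<Longrightarrow> cmod (\<phi> a) \<le> C * opnorm a"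
  shows "fnorm V \<phi> \<le> C"
  unfolding fnorm_def
proof (rule cSup_least)
  show "{cmod (\<phi> a) | a. a \<in> V \<and> opnorm a \<le> 1} \<noteq> {}"
    using op_subspace_0[OF V] opnorm_zero zero_le_one by (metis (mono_tags, lifting) empty_Collect_eq)
  fix r assume "r \<in> {cmod (\<phi> a) | a. a \<in> V \<and> opnorm a \<le> 1}"
  then obtain b where "b \<in> V" "opnorm b \<le> 1" "r = cmod (\<phi> b)" by blast
  then show "r \<le> C" using assms(3)[of b] mult_left_mono[of "opnorm b" 1 C] assms(2) by simp
qed

lemma op_linear_on_zero: "op_subspace V \<Longrightarrow> op_linear_on V f \<Longrightarrow> f 0 = 0"
  using op_linear_on_diff[of V f 0 0] by (simp add: op_subspace_0)

lemma fnorm_nonneg: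
  assumes V: "op_subspace V" "V \<subseteq> BH" and \<phi>: "\<phi> \<in> dual V"
  shows "0 \<le> fnorm V \<phi>"
proof -
  have "bdd_above {cmod (\<phi> a) | a. a \<in> V \<and> opnorm a \<le> 1}"
  proof (rule bdd_aboveI)
    fix r assume "r \<in> {cmod (\<phi> a) | a. a \<in> V \<and> opnorm a \<le> 1}"
    then obtain b where b: "b \<in> V" "opnorm b \<le> 1" "r = cmod (\<phi> b)" by blast
    then have "r \<le> fnorm V \<phi> * opnorm b" using fnorm_bound[OF V \<phi>] by blast
    also have "\<dots> \<le> \<bar>fnorm V \<phi>\<bar> * 1" using b V by (intro mult_mono) (auto intro: opnorm_nonneg)
    finally show "r \<le> \<bar>fnorm V \<phi>\<bar>" by simp
  qed
  moreover have "0 \<in> {cmod (\<phi> a) | a. a \<in> V \<and> opnorm a \<le> 1}"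
    using op_subspace_0[OF V(1)] op_linear_on_zero[OF V(1) dual_linear[OF \<phi>]]
    by (auto intro!: exI[of _ 0])
  ultimately show ?thesis unfolding fnorm_def by (rule cSup_upper[rotated])
qed

lemma dual_comb:
  assumes V: "op_subspace V" "V \<subseteq> BH" and \<phi>: "\<phi> \<in> dual V" and \<psi>: "\<psi> \<in> dual V"
  shows "(\<lambda>a. c * \<phi> a + \<psi> a) \<in> dual V"
proof -
  have "cmod (c * \<phi> a + \<psi> a) \<le> (cmod c * fnorm V \<phi> + fnorm V \<psi>) * opnorm a" if a: "a \<in> V" for a
  proof -
    have "cmod (c * \<phi> a + \<psi> a) \<le> cmod c * cmod (\<phi> a) + cmod (\<psi> a)"
      by (metis norm_mult norm_triangle_ineq)
    also have "\<dots> \<le> cmod c * (fnorm V \<phi> * opnorm a) + fnorm V \<psi> * opnorm a"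
      by (intro add_mono mult_left_mono fnorm_bound[OF V] \<phi> \<psi> a norm_ge_zero)
    finally show ?thesis by (simp add: algebra_simps)
  qed
  then have "\<exists>K. \<forall>a\<in>V. cmod (c * \<phi> a + \<psi> a) \<le> K * opnorm a" by blast
  moreover have "op_linear_on V (\<lambda>a. c * \<phi> a + \<psi> a)"
    using dual_linear[OF \<phi>] dual_linear[OF \<psi>] unfolding op_linear_on_def
    by (simp add: distrib_left mult.left_commute)
  ultimately show ?thesis using \<phi> \<psi> by (simp add: dual_iff)
qed

lemma dual_zero: "op_subspace V \<Longrightarrow> (\<lambda>a. 0) \<in> dual V"
  by (auto simp: dual_iff op_linear_on_def intro!: exI[of _ 0])

lemma bidual_comb:
  "m \<in> bidual X \<Longrightarrow> \<phi> \<in> dual X \<Longrightarrow> \<psi> \<in> dual X \<Longrightarrow> m (\<lambda>a. c * \<phi> a + \<psi> a) = c * m \<phi> + m \<psi>"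
  by (simp add: bidual_def)

lemma bidual_zero: "op_subspace V \<Longrightarrow> m \<in> bidual V \<Longrightarrow> m (\<lambda>a. 0) = 0"
  using bidual_comb[OF _ dual_zero dual_zero, of m V 1] by simp

lemma bidual_bound:
  assumes X: "op_subspace X" "X \<subseteq> BH" and m: "m \<in> bidual X"
  obtains K where "K \<ge> 0" "\<And>\<phi>. \<phi> \<in> dual X \<Longrightarrow> cmod (m \<phi>) \<le> K * fnorm X \<phi>"
proof -
  obtain K where K: "\<And>\<phi>. \<phi> \<in> dual X \<Longrightarrow> cmod (m \<phi>) \<le> K * fnorm X \<phi>"
    using m unfolding bidual_def by blast
  have "cmod (m \<phi>) \<le> \<bar>K\<bar> * fnorm X \<phi>" if "\<phi> \<in> dual X" for \<phi>
    using K[OF that] mult_right_mono[OF abs_ge_self[of K] fnorm_nonneg[OF X that]] by linarith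
  then show ?thesis using that[of "\<bar>K\<bar>"] by simp
qed

text \<open>Mirror image of \<open>fmod_r\<close>. For m in the bidual,
  \<open>m (fmod_l X \<phi> x)\<close> is the Arens product of m with \<open>canon X x\<close>, in
  this order, evaluated at \<phi>; \<open>m (fmod_r X \<phi> x)\<close> is the product in the other
  order.\<close>

definition fmod_l :: "'i op set \<Rightarrow> ('i op \<Rightarrow> complex) \<Rightarrow> 'i op \<Rightarrow> ('i op \<Rightarrow> complex)" where
  "fmod_l X \<phi> x = (\<lambda>a. if a \<in> X then \<phi> (opmult a x) else 0)"

lemma fmod_r_apply: "b \<in> X \<Longrightarrow> fmod_r X \<phi> a b = \<phi> (opmult a b)"
  and fmod_l_apply: "b \<in> X \<Longrightarrow> fmod_l X \<phi> a b = \<phi> (opmult b a)"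
  and bmod_apply: "b \<in> X \<Longrightarrow> bmod X n \<phi> b = n (fmod_r X \<phi> b)"
  by (simp_all add: fmod_r_def fmod_l_def bmod_def)

section \<open>Translates of functionals and the Arens product\<close>

context
  fixes X :: "'i op set"
  assumes X: "subalgebra_BH X"
begin

private lemmas X_sub = subalgebra_BH_subspace[OF X]
private lemmas X_BH = subalgebra_BH_in_BH[OF X]
private lemmas X_mult = subalgebra_BH_mult[OF X]

private lemma X_subset: "X \<subseteq> BH"
  using X_BH by blast

lemma fmod_r_bound:
  assumes \<phi>: "\<phi> \<in> dual X" and a: "a \<in> X" and b: "b \<in> X"
  shows "cmod (\<phi> (opmult a b)) \<le> (fnorm X \<phi> * opnorm a) * opnorm b"
    and "cmod (\<phi> (opmult a b)) \<le> (fnorm X \<phi> * opnorm b) * opnorm a"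
proof -
  have "cmod (\<phi> (opmult a b)) \<le> fnorm X \<phi> * (opnorm a * opnorm b)"
    using fnorm_bound[OF X_sub X_subset \<phi> X_mult[OF a b]]
      mult_left_mono[OF opnorm_opmult_le[OF X_BH[OF a] X_BH[OF b]] fnorm_nonneg[OF X_sub X_subset \<phi>]]
    by linarith
  then show "cmod (\<phi> (opmult a b)) \<le> (fnorm X \<phi> * opnorm a) * opnorm b"
    "cmod (\<phi> (opmult a b)) \<le> (fnorm X \<phi> * opnorm b) * opnorm a"
    by (simp_all add: algebra_simps)
qed

lemma fmod_r_dual:
  assumes \<phi>: "\<phi> \<in> dual X" and a: "a \<in> X"
  shows "fmod_r X \<phi> a \<in> dual X"
  unfolding fmod_r_def
proof (rule dual_restrictI[OF X_sub])
  show "op_linear_on X (\<lambda>b. \<phi> (opmult a b))"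
    using dual_linear[OF \<phi>] a X_BH unfolding op_linear_on_def
    by (simp add: opmult_plus_right opmult_opscale_right X_mult)
qed (rule fmod_r_bound[OF \<phi> a])

lemma fmod_l_dual:
  assumes \<phi>: "\<phi> \<in> dual X" and a: "a \<in> X"
  shows "fmod_l X \<phi> a \<in> dual X"
  unfolding fmod_l_def
proof (rule dual_restrictI[OF X_sub])
  show "op_linear_on X (\<lambda>b. \<phi> (opmult b a))"
    using dual_linear[OF \<phi>] a unfolding op_linear_on_def
    by (simp add: opmult_plus_left opmult_opscale_left X_mult)
qed (rule fmod_r_bound(2)[OF \<phi> _ a])

lemma fnorm_fmod_r_le:
  assumes \<phi>: "\<phi> \<in> dual X" and a: "a \<in> X"
  shows "fnorm X (fmod_r X \<phi> a) \<le> fnorm X \<phi> * opnorm a"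
  by (rule fnorm_le[OF X_sub])
    (use fmod_r_bound[OF \<phi> a] fnorm_nonneg[OF X_sub X_subset \<phi>] X_BH[OF a]
      in \<open>auto simp: fmod_r_apply\<close>)

lemma fmod_r_comb:
  assumes \<phi>: "\<phi> \<in> dual X" and a: "a \<in> X" and b: "b \<in> X"
  shows "fmod_r X \<phi> (opscale c a + b) = (\<lambda>x. c * fmod_r X \<phi> a x + fmod_r X \<phi> b x)"
  using dual_linear[OF \<phi>] a b unfolding op_linear_on_def fmod_r_def
  by (auto simp: opmult_plus_left opmult_opscale_left X_mult)

lemma fmod_l_comb:
  assumes \<phi>: "\<phi> \<in> dual X" and a: "a \<in> X" and b: "b \<in> X"
  shows "fmod_l X \<phi> (opscale c a + b) = (\<lambda>x. c * fmod_l X \<phi> a x + fmod_l X \<phi> b x)"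
  using dual_linear[OF \<phi>] a b unfolding op_linear_on_def fmod_l_def
  by (auto simp: opmult_plus_right opmult_opscale_right X_mult X_BH)

lemma bmod_dual:
  assumes n: "n \<in> bidual X" and \<phi>: "\<phi> \<in> dual X"
  shows "bmod X n \<phi> \<in> dual X"
proof -
  obtain K where K: "K \<ge> 0" "\<And>\<phi>. \<phi> \<in> dual X \<Longrightarrow> cmod (n \<phi>) \<le> K * fnorm X \<phi>"
    using bidual_bound[OF X_sub X_subset n] by blast
  show ?thesis
    unfolding bmod_def
  proof (rule dual_restrictI[OF X_sub])
    show "op_linear_on X (\<lambda>a. n (fmod_r X \<phi> a))"
      unfolding op_linear_on_def
      by (simp add: fmod_r_comb[OF \<phi>] bidual_comb[OF n] fmod_r_dual[OF \<phi>])
    show "cmod (n (fmod_r X \<phi> a)) \<le> (K * fnorm X \<phi>) * opnorm a" if a: "a \<in> X" for a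
      using K(2)[OF fmod_r_dual[OF \<phi> a]] mult_left_mono[OF fnorm_fmod_r_le[OF \<phi> a] K(1)]
      by (simp add: mult.assoc)
  qed
qed

lemma fmod_r_fmod_r:
  assumes "a \<in> X" "b \<in> X"
  shows "fmod_r X (fmod_r X \<phi> a) b = fmod_r X \<phi> (opmult a b)"
  by (auto simp: fmod_r_def fun_eq_iff opmult_assoc assms X_mult)

lemma fmod_l_fmod_l:
  assumes "a \<in> X" "b \<in> X"
  shows "fmod_l X (fmod_l X \<phi> b) a = fmod_l X \<phi> (opmult a b)"
  by (auto simp: fmod_l_def fun_eq_iff opmult_assoc assms X_mult)

lemma fmod_r_bmod:
  assumes "a \<in> X"
  shows "fmod_r X (bmod X n \<phi>) a = bmod X n (fmod_r X \<phi> a)"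
proof
  fix b show "fmod_r X (bmod X n \<phi>) a b = bmod X n (fmod_r X \<phi> a) b"
    using assms
    by (cases "b \<in> X") (simp_all add: fmod_r_apply bmod_apply fmod_r_fmod_r X_mult,
      simp add: fmod_r_def bmod_def)
qed

section \<open>Corners of an idempotent and weak* closures\<close>

lemma canon_bidual:
  assumes x: "x \<in> X"
  shows "canon X x \<in> bidual X"
proof -
  have "cmod (canon X x \<phi>) \<le> opnorm x * fnorm X \<phi>" if \<phi>: "\<phi> \<in> dual X" for \<phi>
    using fnorm_bound[OF X_sub X_subset \<phi> x] \<phi> by (simp add: canon_def mult.commute)
  then show ?thesis
    by (auto simp: bidual_def canon_def dual_comb[OF X_sub X_subset])
qed

text \<open>The two conditions are p x = x and x p = x in the bidual, tested on functionals. They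
  follow from x = p m p and idempotence; conversely, \<open>canon X x\<close> serves as m. Being
  linear in x and free of m, they are the working form of membership in the corner.\<close>

lemma corner_iff:
  assumes p: "p \<in> bidual X" and idem: "arens X p p = p"
  shows "x \<in> corner X p \<longleftrightarrow>
    x \<in> X \<and> (\<forall>\<theta>\<in>dual X. p (fmod_l X \<theta> x) = \<theta> x \<and> p (fmod_r X \<theta> x) = \<theta> x)"
proof
  have idem': "p (bmod X p \<theta>) = p \<theta>" if "\<theta> \<in> dual X" for \<theta>
    using fun_cong[OF idem, of \<theta>] that by (simp add: arens_def)
  assume "x \<in> corner X p"
  then obtain m where x: "x \<in> X" and m: "m \<in> bidual X"
    and eq: "canon X x = arens X (arens X p m) p"
    by (auto simp: corner_def)
  have ev: "\<theta> x = p (bmod X m (bmod X p \<theta>))" if \<theta>: "\<theta> \<in> dual X" for \<theta>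
    using fun_cong[OF eq, of \<theta>] \<theta> bmod_dual[OF p \<theta>] by (simp add: canon_def arens_def)
  have "p (fmod_l X \<theta> x) = \<theta> x \<and> p (fmod_r X \<theta> x) = \<theta> x" if \<theta>: "\<theta> \<in> dual X" for \<theta>
  proof
    let ?\<omega> = "bmod X m (bmod X p \<theta>)"
    have \<omega>: "?\<omega> \<in> dual X" by (intro bmod_dual m p \<theta>)
    \<comment> \<open>Applying \<open>ev\<close> to all translates of \<theta> exhibits the
      translate by x as something already multiplied by p, so that idempotence removes one more
      p.\<close>
    have "fmod_l X \<theta> x = bmod X p ?\<omega>"
    proof
      fix a show "fmod_l X \<theta> x a = bmod X p ?\<omega> a"
      proof (cases "a \<in> X")
        case True
        have "fmod_l X \<theta> x a = fmod_r X \<theta> a x" using True x by (simp add: fmod_l_apply fmod_r_apply)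
        also have "\<dots> = p (bmod X m (bmod X p (fmod_r X \<theta> a)))" by (rule ev[OF fmod_r_dual[OF \<theta> True]])
        also have "\<dots> = bmod X p ?\<omega> a" using True by (simp add: bmod_apply fmod_r_bmod)
        finally show ?thesis .
      qed (simp add: fmod_l_def bmod_def)
    qed
    then show "p (fmod_l X \<theta> x) = \<theta> x" using idem'[OF \<omega>] ev[OF \<theta>] by simp
    let ?\<theta>' = "bmod X p \<theta>"
    \<comment> \<open>Multiplication by p is idempotent on functionals as well. By
      \<open>ev\<close>, x then takes the same value on \<theta> and on its product with p, which is
      x p = x.\<close>
    have "bmod X p ?\<theta>' = ?\<theta>'"
    proof
      fix a show "bmod X p ?\<theta>' a = ?\<theta>' a"
        using idem'[OF fmod_r_dual[OF \<theta>, of a]]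
        by (cases "a \<in> X") (simp_all add: bmod_apply fmod_r_bmod, simp add: bmod_def)
    qed
    then have "?\<theta>' x = \<theta> x" using ev[OF bmod_dual[OF p \<theta>]] ev[OF \<theta>] by simp
    then show "p (fmod_r X \<theta> x) = \<theta> x" using x by (simp add: bmod_apply)
  qed
  then show "x \<in> X \<and> (\<forall>\<theta>\<in>dual X. p (fmod_l X \<theta> x) = \<theta> x \<and> p (fmod_r X \<theta> x) = \<theta> x)"
    using x by blast
next
  assume *: "x \<in> X \<and> (\<forall>\<theta>\<in>dual X. p (fmod_l X \<theta> x) = \<theta> x \<and> p (fmod_r X \<theta> x) = \<theta> x)"
  then have x: "x \<in> X" by blast
  have "canon X x = arens X (arens X p (canon X x)) p"
  proof
    fix \<theta> show "canon X x \<theta> = arens X (arens X p (canon X x)) p \<theta>"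
    proof (cases "\<theta> \<in> dual X")
      case True
      \<comment> \<open>This consumes x p = x, at the translates of \<theta>; the other p is
        absorbed afterwards by p x = x.\<close>
      have "bmod X (canon X x) (bmod X p \<theta>) = fmod_l X \<theta> x"
      proof
        fix a show "bmod X (canon X x) (bmod X p \<theta>) a = fmod_l X \<theta> x a"
        proof (cases "a \<in> X")
          case a: True
          have d: "fmod_r X \<theta> a \<in> dual X" by (rule fmod_r_dual[OF True a])
          have "bmod X (canon X x) (bmod X p \<theta>) a = p (fmod_r X (fmod_r X \<theta> a) x)"
            using a x bmod_dual[OF p d] by (simp add: bmod_apply fmod_r_bmod canon_def)
          also have "\<dots> = fmod_r X \<theta> a x" using * d by blast
          finally show ?thesis using a x by (simp add: fmod_r_apply fmod_l_apply)
        qed (simp add: fmod_l_def bmod_def)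
      qed
      then show ?thesis using True * bmod_dual[OF p True] by (simp add: canon_def arens_def)
    qed (simp add: canon_def arens_def)
  qed
  then show "x \<in> corner X p" using x canon_bidual[OF x] by (auto simp: corner_def)
qed

lemma op_subspace_corner:
  assumes p: "p \<in> bidual X" and idem: "arens X p p = p"
  shows "op_subspace (corner X p)"
proof -
  note iff = corner_iff[OF p idem]
  have zero: "0 \<in> corner X p"
  proof -
    have "fmod_l X \<theta> 0 = (\<lambda>a. 0) \<and> fmod_r X \<theta> 0 = (\<lambda>a. 0) \<and> \<theta> 0 = 0" if \<theta>: "\<theta> \<in> dual X" for \<theta>
    proof -
      have 0: "\<theta> 0 = 0" by (rule op_linear_on_zero[OF X_sub dual_linear[OF \<theta>]])
      have "opmult 0 a = 0" for a :: "'i op" by (simp add: fun_eq_iff)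
      moreover have "opmult a 0 = 0" if "a \<in> X" for a
        using opmult_minus_right[OF X_BH[OF that] BH_zero_op BH_zero_op] by simp
      ultimately show ?thesis using 0 by (auto simp: fmod_l_def fmod_r_def)
    qed
    then show ?thesis
      using op_subspace_0[OF X_sub] bidual_zero[OF X_sub p] by (simp add: iff)
  qed
  have comb: "opscale c x + y \<in> corner X p" if x: "x \<in> corner X p" and y: "y \<in> corner X p" for x y c
  proof -
    have xX: "x \<in> X" and yX: "y \<in> X" using x y by (auto simp: iff)
    have "opscale c x + y \<in> X" using xX yX by (intro op_subspace_add op_subspace_scale X_sub)
    moreover have "p (fmod_l X \<theta> (opscale c x + y)) = \<theta> (opscale c x + y)
        \<and> p (fmod_r X \<theta> (opscale c x + y)) = \<theta> (opscale c x + y)" if \<theta>: "\<theta> \<in> dual X" for \<theta>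
      using x y \<theta> dual_linear[OF \<theta>] xX yX unfolding op_linear_on_def
      by (simp add: iff fmod_l_comb[OF \<theta>] fmod_r_comb[OF \<theta>] bidual_comb[OF p] fmod_l_dual fmod_r_dual)
    ultimately show ?thesis by (simp add: iff)
  qed
  show ?thesis
    unfolding op_subspace_def
    using zero comb[of _ _ 1] comb[OF _ zero] by (simp add: opscale_algebra)
qed

text \<open>Translating \<theta> by d a e amounts to translating by a e first and then by d. So p
  meets only d, at another functional, and is absorbed there; on the other side it meets only
  e.\<close>

lemma corner_hereditary:
  assumes p: "p \<in> bidual X" and idem: "arens X p p = p"
    and d: "d \<in> corner X p" and e: "e \<in> corner X p" and a: "a \<in> X"
  shows "opmult (opmult d a) e \<in> corner X p"
proof -
  note iff = corner_iff[OF p idem]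
  have dX: "d \<in> X" and eX: "e \<in> X" using d e by (auto simp: iff)
  have "p (fmod_l X \<theta> (opmult (opmult d a) e)) = \<theta> (opmult (opmult d a) e)
      \<and> p (fmod_r X \<theta> (opmult (opmult d a) e)) = \<theta> (opmult (opmult d a) e)"
    if \<theta>: "\<theta> \<in> dual X" for \<theta>
  proof
    have "p (fmod_l X (fmod_l X \<theta> (opmult a e)) d) = fmod_l X \<theta> (opmult a e) d"
      using d fmod_l_dual[OF \<theta> X_mult[OF a eX]] by (simp add: iff)
    then show "p (fmod_l X \<theta> (opmult (opmult d a) e)) = \<theta> (opmult (opmult d a) e)"
      using dX eX a by (simp add: fmod_l_fmod_l X_mult fmod_l_apply opmult_assoc)
    have "p (fmod_r X (fmod_r X \<theta> (opmult d a)) e) = fmod_r X \<theta> (opmult d a) e"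
      using e fmod_r_dual[OF \<theta> X_mult[OF dX a]] by (simp add: iff)
    then show "p (fmod_r X \<theta> (opmult (opmult d a) e)) = \<theta> (opmult (opmult d a) e)"
      using dX eX a by (simp add: fmod_r_fmod_r X_mult fmod_r_apply)
  qed
  then show ?thesis using dX eX a by (simp add: iff X_mult)
qed

text \<open>A weak* limit of points of \<open>S\<close> depends only on the restriction of \<xi> to
  \<open>S\<close>. So \<xi> may be exchanged for a Hahn-Banach extension of this restriction with
  norm at most \<open>C\<close>, even if \<xi> itself is large on \<open>X\<close>.\<close>

lemma wstar_closure_bound:
  assumes p: "p \<in> wstar_closure X S" and S: "op_subspace S" "S \<subseteq> X"
    and K: "\<And>\<phi>. \<phi> \<in> dual X \<Longrightarrow> cmod (p \<phi>) \<le> K * fnorm X \<phi>" "K \<ge> 0"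
    and \<xi>: "\<xi> \<in> dual X" and C: "C \<ge> 0" "\<And>s. s \<in> S \<Longrightarrow> cmod (\<xi> s) \<le> C * opnorm s"
  shows "cmod (p \<xi>) \<le> K * C"
proof -
  have p_bid: "p \<in> bidual X" using p by (simp add: wstar_closure_def)
  have vanish: "p \<psi> = 0" if \<psi>: "\<psi> \<in> dual X" "\<And>s. s \<in> S \<Longrightarrow> \<psi> s = 0" for \<psi>
  proof (rule ccontr)
    assume "p \<psi> \<noteq> 0"
    have "\<exists>s\<in>S. \<forall>\<phi>\<in>F. cmod (p \<phi> - \<phi> s) < e" if "finite F" "F \<subseteq> dual X" "e > 0" for F e
      using p that by (simp add: wstar_closure_def)
    \<comment> \<open>With |p \<psi>| itself as the tolerance, an approximating s with \<psi> s = 0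
      is absurd.\<close>
    from this[of "{\<psi>}" "cmod (p \<psi>)"] have "\<exists>s\<in>S. cmod (p \<psi> - \<psi> s) < cmod (p \<psi>)"
      using \<psi>(1) \<open>p \<psi> \<noteq> 0\<close> by simp
    then show False using \<psi>(2) by auto
  qed
  have lin: "op_linear_on S \<xi>"
    using dual_linear[OF \<xi>] S(2) unfolding op_linear_on_def by blast
  obtain g where g: "op_linear_on X g" "\<And>x. x \<in> X \<Longrightarrow> cmod (g x) \<le> C * opnorm x"
      "\<And>x. x \<in> S \<Longrightarrow> g x = \<xi> x"
  proof (rule hahn_banach_complex[OF X_sub S, of "\<lambda>x. C * opnorm x" \<xi>])
    show "C * opnorm (x + y) \<le> C * opnorm x + C * opnorm y" if "x \<in> X" "y \<in> X" for x y
      using mult_left_mono[OF opnorm_triangle[OF X_BH[OF that(1)] X_BH[OF that(2)]] C(1)]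
      by (simp add: distrib_left)
    show "C * opnorm (opscale c x) = cmod c * (C * opnorm x)" if "x \<in> X" for x c
      using opnorm_opscale[OF X_BH[OF that]] by simp
    show "op_linear_on S \<xi>" by (rule lin)
    show "cmod (\<xi> x) \<le> C * opnorm x" if "x \<in> S" for x by (rule C(2)[OF that])
  qed blast
  define h where "h = (\<lambda>a. if a \<in> X then g a else 0)"
  have h: "h \<in> dual X" unfolding h_def by (rule dual_restrictI[OF X_sub g(1,2)])
  have "fnorm X h \<le> C" by (rule fnorm_le[OF X_sub C(1)]) (simp add: h_def g(2))
  then have ph: "cmod (p h) \<le> K * C" using K(1)[OF h] mult_left_mono[OF _ K(2), of "fnorm X h" C] by linarith
  have "(\<lambda>a. (-1) * h a + \<xi> a) \<in> dual X" by (rule dual_comb[OF X_sub X_subset h \<xi>])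
  then have "p (\<lambda>a. (-1) * h a + \<xi> a) = 0"
    by (rule vanish) (use g(3) S(2) in \<open>auto simp: h_def\<close>)
  then have "p \<xi> = p h" using bidual_comb[OF p_bid h \<xi>, of "-1"] by simp
  then show ?thesis using ph by simp
qed

lemma dual_BH_restrict:
  assumes "\<xi> \<in> dual BH"
  shows "(\<lambda>a. if a \<in> X then \<xi> a else 0) \<in> dual X"
proof (rule dual_restrictI[OF X_sub])
  show "op_linear_on X \<xi>" using dual_linear[OF assms] X_BH unfolding op_linear_on_def by blast
  show "cmod (\<xi> a) \<le> fnorm BH \<xi> * opnorm a" if "a \<in> X" for a
    by (rule fnorm_bound[OF op_subspace_BH order_refl assms X_BH[OF that]])
qed

end

section \<open>The involution and self-adjoint projections\<close>

lemma fstar_dual: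
  assumes \<xi>: "\<xi> \<in> dual BH"
  shows "fstar \<xi> \<in> dual BH"
  unfolding fstar_def
proof (rule dual_restrictI[OF op_subspace_BH])
  show "op_linear_on BH (\<lambda>T. cnj (\<xi> (opadj T)))"
    using dual_linear[OF \<xi>] unfolding op_linear_on_def
    by (simp add: opadj_plus opadj_opscale)
  show "cmod (cnj (\<xi> (opadj T))) \<le> fnorm BH \<xi> * opnorm T" if "T \<in> BH" for T
    using fnorm_bound[OF op_subspace_BH order_refl \<xi> opadj_BH[OF that]] that by simp
qed

text \<open>This is the only place where self-adjointness of the projection enters.\<close>

lemma selfadjoint_corner:
  assumes A: "subalgebra_BH A" and p: "projection_bidual A p"
    and x: "x \<in> corner A p" and \<xi>: "\<xi> \<in> dual BH"
  shows "p (\<lambda>a. if a \<in> A then \<xi> (opmult (opadj x) a) else 0) = \<xi> (opadj x)"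
    and "p (\<lambda>a. if a \<in> A then \<xi> (opmult a (opadj x)) else 0) = \<xi> (opadj x)"
proof -
  define r where "r \<psi> = (\<lambda>a. if a \<in> A then \<psi> a else 0)" for \<psi> :: "'a op \<Rightarrow> complex"
  have p': "p \<in> bidual A" "arens A p p = p" and sa: "bstar (bid_incl A p) = bid_incl A p"
    using p by (auto simp: projection_bidual_def)
  \<comment> \<open>Self-adjointness of p in the bidual of B(H), pulled back to \<open>A\<close>
    along the restriction of functionals.\<close>
  have star: "p (r \<psi>) = cnj (p (r (fstar \<psi>)))" if \<psi>: "\<psi> \<in> dual BH" for \<psi>
    using fun_cong[OF sa, of \<psi>] \<psi> fstar_dual[OF \<psi>] by (simp add: bstar_def bid_incl_def r_def)
  note iff = corner_iff[OF A p']
  have xA: "x \<in> A" using x by (simp add: iff)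
  have x_BH: "x \<in> BH" and A_BH: "\<And>a. a \<in> A \<Longrightarrow> a \<in> BH"
    using subalgebra_BH_in_BH[OF A] xA by auto
  let ?\<theta> = "r (fstar \<xi>)"
  have \<theta>: "?\<theta> \<in> dual A" unfolding r_def by (rule dual_BH_restrict[OF A fstar_dual[OF \<xi>]])
  have \<theta>x: "cnj (?\<theta> x) = \<xi> (opadj x)" using xA x_BH by (simp add: r_def fstar_def)
  note BH_alg = subalgebra_BH_BH
  have "r (fstar (fmod_r BH \<xi> (opadj x))) = fmod_l A ?\<theta> x"
    using x_BH A_BH xA subalgebra_BH_mult[OF A]
    by (auto simp: r_def fstar_def fmod_l_def fmod_r_apply fun_eq_iff opadj_opmult)
  then have "p (r (fmod_r BH \<xi> (opadj x))) = \<xi> (opadj x)"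
    using star[OF fmod_r_dual[OF BH_alg \<xi> opadj_BH[OF x_BH]]] x \<theta> \<theta>x by (simp add: iff)
  moreover have "r (fmod_r BH \<xi> (opadj x)) = (\<lambda>a. if a \<in> A then \<xi> (opmult (opadj x) a) else 0)"
    using A_BH by (auto simp: r_def fmod_r_apply)
  ultimately show "p (\<lambda>a. if a \<in> A then \<xi> (opmult (opadj x) a) else 0) = \<xi> (opadj x)" by simp
  have "r (fstar (fmod_l BH \<xi> (opadj x))) = fmod_r A ?\<theta> x"
    using x_BH A_BH xA subalgebra_BH_mult[OF A]
    by (auto simp: r_def fstar_def fmod_r_def fmod_l_apply fun_eq_iff opadj_opmult)
  then have "p (r (fmod_l BH \<xi> (opadj x))) = \<xi> (opadj x)"
    using star[OF fmod_l_dual[OF BH_alg \<xi> opadj_BH[OF x_BH]]] x \<theta> \<theta>x by (simp add: iff)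
  moreover have "r (fmod_l BH \<xi> (opadj x)) = (\<lambda>a. if a \<in> A then \<xi> (opmult a (opadj x)) else 0)"
    using A_BH by (auto simp: r_def fmod_l_apply)
  ultimately show "p (\<lambda>a. if a \<in> A then \<xi> (opmult a (opadj x)) else 0) = \<xi> (opadj x)" by simp
qed

section \<open>Unique Hahn--Banach extensions\<close>

text \<open>Hahn--Banach is applied to the seminorm \<open>w \<mapsto> INF d\<in>D. \<parallel>w - \<tau> d\<parallel> / \<delta> + \<parallel>d\<parallel> / K\<close>;
  its value at \<open>v\<close> being less than 1 is what is claimed.\<close>

lemma bounded_approximation:
  assumes D: "op_subspace D" "D \<subseteq> BH"
    and \<tau>_BH: "\<And>d. d \<in> D \<Longrightarrow> \<tau> d \<in> BH"
    and \<tau>_add: "\<And>d e. d \<in> D \<Longrightarrow> e \<in> D \<Longrightarrow> \<tau> (d + e) = \<tau> d + \<tau> e"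
    and \<tau>_scale: "\<And>d c. d \<in> D \<Longrightarrow> \<tau> (opscale c d) = opscale c (\<tau> d)"
    and v: "v \<in> BH" and K: "K > 0" and \<delta>: "\<delta> > 0"
    and sep: "\<And>g. g \<in> dual BH \<Longrightarrow> (\<And>d. d \<in> D \<Longrightarrow> cmod (g (\<tau> d)) \<le> opnorm d / K) \<Longrightarrow> cmod (g v) < 1"
  shows "\<exists>d\<in>D. opnorm d \<le> K \<and> opnorm (v - \<tau> d) \<le> \<delta>"
proof -
  define w where "w z d = opnorm (z - \<tau> d) / \<delta> + opnorm d / K" for z d
  define q where "q z = (INF d\<in>D. w z d)" for z
  have D_BH: "d \<in> BH" if "d \<in> D" for d using that D(2) by blast
  have D0: "0 \<in> D" by (rule op_subspace_0[OF D(1)])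
  have w_nonneg: "0 \<le> w z d" if "z \<in> BH" "d \<in> D" for z d
    unfolding w_def using that K \<delta> by (intro add_nonneg_nonneg divide_nonneg_pos opnorm_nonneg)
      (auto simp: \<tau>_BH D_BH)
  have q_le: "q z \<le> w z d" if "z \<in> BH" "d \<in> D" for z d
    unfolding q_def by (rule cINF_lower[OF bdd_belowI2[of _ 0]]) (use w_nonneg that in auto)
  have q_ge: "c \<le> q z" if "\<And>d. d \<in> D \<Longrightarrow> c \<le> w z d" for c z
    unfolding q_def by (rule cINF_greatest) (use D0 that in auto)
  have q_nonneg: "0 \<le> q z" if "z \<in> BH" for z using q_ge w_nonneg that by blast
  have \<tau>0: "\<tau> 0 = 0" using \<tau>_scale[OF D0, of 0] by (simp add: opscale_algebra)
  \<comment> \<open>Taking d = 0 bounds \<open>q\<close> by a multiple of the norm, so functionals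
    dominated by \<open>q\<close> are continuous.\<close>
  have q_opnorm: "q z \<le> opnorm z / \<delta>" if "z \<in> BH" for z
    using q_le[OF that D0] by (simp add: w_def \<tau>0)
  have q_0: "q 0 = 0" using q_opnorm[of 0] q_nonneg[of 0] by simp
  have q_\<tau>: "q (\<tau> d) \<le> opnorm d / K" if "d \<in> D" for d
    using q_le[OF \<tau>_BH[OF that] that] by (simp add: w_def)
  have q_add: "q (y + z) \<le> q y + q z" if y: "y \<in> BH" and z: "z \<in> BH" for y z
  proof -
    have "q (y + z) - w y d \<le> q z" if d: "d \<in> D" for d
    proof (rule q_ge)
      fix e assume e: "e \<in> D"
      have "opnorm (y + z - \<tau> (d + e)) \<le> opnorm (y - \<tau> d) + opnorm (z - \<tau> e)"
        using opnorm_triangle[of "y - \<tau> d" "z - \<tau> e"] y z d e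
        by (simp add: \<tau>_add \<tau>_BH algebra_simps)
      then have "opnorm (y + z - \<tau> (d + e)) / \<delta> \<le> opnorm (y - \<tau> d) / \<delta> + opnorm (z - \<tau> e) / \<delta>"
        using divide_right_mono[of _ _ \<delta>] \<delta> by (simp flip: add_divide_distrib)
      moreover have "opnorm (d + e) / K \<le> opnorm d / K + opnorm e / K"
        using opnorm_triangle[OF D_BH[OF d] D_BH[OF e]] divide_right_mono[of _ _ K] K
        by (simp flip: add_divide_distrib)
      moreover have "q (y + z) \<le> w (y + z) (d + e)"
        by (rule q_le) (use y z d e D in \<open>auto intro: op_subspace_add\<close>)
      ultimately show "q (y + z) - w y d \<le> w z e" by (simp add: w_def)
    qed
    then have "q (y + z) - q z \<le> q y" by (intro q_ge) (simp add: algebra_simps)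
    then show ?thesis by simp
  qed
  have q_scale_le: "q (opscale c z) \<le> cmod c * q z" if z: "z \<in> BH" and c: "c \<noteq> 0" for c z
  proof -
    have "q (opscale c z) / cmod c \<le> q z"
    proof (rule q_ge)
      fix d assume d: "d \<in> D"
      have "opscale c z - \<tau> (opscale c d) = opscale c (z - \<tau> d)"
        by (simp add: \<tau>_scale[OF d] fun_eq_iff algebra_simps)
      then have "w (opscale c z) (opscale c d) = cmod c * w z d"
        using z d by (simp add: w_def opnorm_opscale D_BH \<tau>_BH algebra_simps)
      then show "q (opscale c z) / cmod c \<le> w z d"
        using q_le[of "opscale c z" "opscale c d"] z d c D(1)
        by (simp add: op_subspace_scale field_simps)
    qed
    then show ?thesis using c by (simp add: field_simps)
  qed
  have q_scale: "q (opscale c z) = cmod c * q z" if z: "z \<in> BH" for c z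
  proof (cases "c = 0")
    case False
    have "q z \<le> q (opscale c z) / cmod c"
      using q_scale_le[of "opscale c z" "1 / c"] z False
      by (simp add: opscale_algebra norm_divide)
    then show ?thesis using q_scale_le[OF z False] False by (simp add: field_simps)
  qed (simp add: opscale_algebra q_0)
  have "q v < 1"
  proof (rule ccontr)
    assume "\<not> q v < 1"
    then have qv: "q v \<ge> 1" by simp
    define L where "L = range (\<lambda>c. opscale c v)"
    \<comment> \<open>The functional on the line through \<open>v\<close> that attains the seminorm
      at \<open>v\<close>. Reading off the scalar is unambiguous because \<open>q v\<close> is
      positive.\<close>
    define f where "f z = (SOME c. z = opscale c v) * of_real (q v)" for z
    have inj: "c = c'" if "opscale c v = opscale c' v" for c c'
    proof -
      have "opscale (c - c') v = 0" using that by (simp add: fun_eq_iff left_diff_distrib)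
      then have "cmod (c - c') * q v = 0" using q_scale[OF v, of "c - c'"] q_0 by simp
      then show ?thesis using qv by simp
    qed
    have f: "f (opscale c v) = c * of_real (q v)" for c
    proof -
      have "(SOME c'. opscale c v = opscale c' v) = c"
        by (rule some_equality) (auto dest: inj)
      then show ?thesis by (simp add: f_def)
    qed
    have L_comb: "opscale c (opscale a v) + opscale b v = opscale (c * a + b) v" for a b c
      by (simp add: opscale_algebra)
    have L: "op_subspace L"
      unfolding op_subspace_def
    proof (intro conjI ballI allI)
      show "0 \<in> L" using rangeI[of "\<lambda>c. opscale c v" 0] by (simp add: L_def opscale_algebra(5))
      show "x + y \<in> L" if "x \<in> L" "y \<in> L" for x y
        using that by (auto simp: L_def simp flip: opscale_algebra(2))
      show "opscale c x \<in> L" if "x \<in> L" for x c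
        using that by (auto simp: L_def opscale_algebra(3))
    qed
    have LBH: "L \<subseteq> BH" using v by (auto simp: L_def)
    have f_lin: "op_linear_on L f"
      unfolding op_linear_on_def L_def by (auto simp: L_comb f distrib_right)
    have f_le: "cmod (f z) \<le> q z" if "z \<in> L" for z
      using that v q_nonneg[OF v] by (auto simp: L_def f q_scale norm_mult)
    obtain g where g: "op_linear_on BH g" "\<And>z. z \<in> BH \<Longrightarrow> cmod (g z) \<le> q z"
        "\<And>z. z \<in> L \<Longrightarrow> g z = f z"
    proof (rule hahn_banach_complex[OF op_subspace_BH L LBH, of q f])
      show "q (y + z) \<le> q y + q z" if "y \<in> BH" "z \<in> BH" for y z by (rule q_add[OF that])
      show "q (opscale c z) = cmod c * q z" if "z \<in> BH" for z c by (rule q_scale[OF that])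
      show "op_linear_on L f" by (rule f_lin)
      show "cmod (f z) \<le> q z" if "z \<in> L" for z by (rule f_le[OF that])
    qed blast
    define h where "h = (\<lambda>a. if a \<in> BH then g a else 0)"
    have "cmod (g z) \<le> (1 / \<delta>) * opnorm z" if "z \<in> BH" for z
      using g(2)[OF that] q_opnorm[OF that] by simp
    then have h: "h \<in> dual BH" unfolding h_def by (intro dual_restrictI op_subspace_BH g(1))
    \<comment> \<open>Choosing d itself in the infimum makes the first summand vanish, so
      \<open>h\<close> meets the premise of \<open>sep\<close>, although its value at
      \<open>v\<close> is \<open>q v\<close>, at least 1.\<close>
    have "cmod (h (\<tau> d)) \<le> opnorm d / K" if "d \<in> D" for d
      using g(2)[OF \<tau>_BH[OF that]] q_\<tau>[OF that] \<tau>_BH[OF that] by (simp add: h_def)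
    then have "cmod (h v) < 1" by (rule sep[OF h])
    moreover have "h v = of_real (q v)"
    proof -
      have "v = opscale 1 v" by (simp add: opscale_algebra)
      then have "v \<in> L" "f v = of_real (q v)" using f[of 1] by (auto simp: L_def)
      then show ?thesis using g(3) v by (simp add: h_def)
    qed
    ultimately show False using qv by simp
  qed
  then obtain d where d: "d \<in> D" "w v d < 1" using q_ge[of 1 v] by (meson not_le)
  have nn: "0 \<le> opnorm (v - \<tau> d) / \<delta>" "0 \<le> opnorm d / K"
    using d(1) v K \<delta> by (auto intro!: divide_nonneg_pos opnorm_nonneg simp: \<tau>_BH D_BH)
  then have "opnorm d / K \<le> 1" "opnorm (v - \<tau> d) / \<delta> \<le> 1" using d(2) by (simp_all add: w_def)
  then show ?thesis using d(1) K \<delta> by (auto simp: field_simps)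
qed

text \<open>If |g(x^* d)| \<le> |d| / K on the corner, then g(x^* ) is the value of p at the
  translate of g, hence at most K0 / K < 1 by \<open>wstar_closure_bound\<close>. This is the
  separation hypothesis of \<open>bounded_approximation\<close>. The element d varies with x and
  \<delta>, but K does not.\<close>

lemma corner_approximate_identity:
  assumes A: "subalgebra_BH A" and p: "open_projection A p"
  obtains K where "K \<ge> 1"
    "\<And>x \<delta>. x \<in> corner A p \<Longrightarrow> \<delta> > 0 \<Longrightarrow>
      \<exists>d\<in>corner A p. opnorm d \<le> K \<and> opnorm (opadj x - opmult (opadj x) d) \<le> \<delta>"
    "\<And>x \<delta>. x \<in> corner A p \<Longrightarrow> \<delta> > 0 \<Longrightarrow>
      \<exists>d\<in>corner A p. opnorm d \<le> K \<and> opnorm (opadj x - opmult d (opadj x)) \<le> \<delta>"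
proof -
  let ?D = "corner A p"
  have proj: "projection_bidual A p" and p_wstar: "p \<in> wstar_closure A ?D"
    using p by (auto simp: open_projection_def)
  then have p_bid: "p \<in> bidual A" "arens A p p = p" by (auto simp: projection_bidual_def)
  note D = op_subspace_corner[OF A p_bid]
  have DA: "?D \<subseteq> A" by (auto simp: corner_def)
  have A_BH: "A \<subseteq> BH" using subalgebra_BH_in_BH[OF A] by blast
  then have D_BH: "d \<in> BH" if "d \<in> ?D" for d using DA that by blast
  obtain K0 where K0: "K0 \<ge> 0" "\<And>\<phi>. \<phi> \<in> dual A \<Longrightarrow> cmod (p \<phi>) \<le> K0 * fnorm A \<phi>"
    using bidual_bound[OF subalgebra_BH_subspace[OF A] A_BH p_bid(1)] by blast
  \<comment> \<open>\<open>K0\<close> bounds p; the extra 1 makes \<open>K0 / K\<close> strictly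
    less than 1 and gives \<open>K \<ge> 1\<close>.\<close>
  define K where "K = K0 + 1"
  have K: "K \<ge> 1" "K > 0" "K0 * (1 / K) < 1" using K0(1) by (auto simp: K_def)
  have small: "cmod (g (opadj x)) < 1"
    if eq: "p (\<lambda>a. if a \<in> A then g (\<tau> a) else 0) = g (opadj x)"
      and dual: "(\<lambda>a. if a \<in> A then g (\<tau> a) else 0) \<in> dual A"
      and le: "\<And>d. d \<in> ?D \<Longrightarrow> cmod (g (\<tau> d)) \<le> opnorm d / K" for g \<tau> and x :: "'a op"
  proof -
    have "cmod (p (\<lambda>a. if a \<in> A then g (\<tau> a) else 0)) \<le> K0 * (1 / K)"
      by (rule wstar_closure_bound[OF A p_wstar D DA K0(2,1) dual])
        (use K le DA in \<open>simp_all add: subset_iff\<close>)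
    then show ?thesis using eq K(3) by simp
  qed
  have left: "\<exists>d\<in>?D. opnorm d \<le> K \<and> opnorm (opadj x - opmult (opadj x) d) \<le> \<delta>"
    if x: "x \<in> ?D" and \<delta>: "\<delta> > 0" for x \<delta>
  proof -
    have x': "opadj x \<in> BH" using x DA A_BH by auto
    have "cmod (g (opadj x)) < 1" if g: "g \<in> dual BH"
      and le: "\<And>d. d \<in> ?D \<Longrightarrow> cmod (g (opmult (opadj x) d)) \<le> opnorm d / K" for g
    proof (rule small[where \<tau> = "opmult (opadj x)", OF selfadjoint_corner(1)[OF A proj x g] _ le])
      show "(\<lambda>a. if a \<in> A then g (opmult (opadj x) a) else 0) \<in> dual A"
        using dual_BH_restrict[OF A fmod_r_dual[OF subalgebra_BH_BH g x']] A_BH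
        by (simp add: fmod_r_def subset_iff cong: if_cong)
    qed
    then show ?thesis
      using bounded_approximation[of ?D "opmult (opadj x)" "opadj x" K \<delta>] D D_BH K(2) \<delta> x'
      by (simp add: opmult_plus_right opmult_opscale_right subset_iff)
  qed
  have right: "\<exists>d\<in>?D. opnorm d \<le> K \<and> opnorm (opadj x - opmult d (opadj x)) \<le> \<delta>"
    if x: "x \<in> ?D" and \<delta>: "\<delta> > 0" for x \<delta>
  proof -
    have x': "opadj x \<in> BH" using x DA A_BH by auto
    have "cmod (g (opadj x)) < 1" if g: "g \<in> dual BH"
      and le: "\<And>d. d \<in> ?D \<Longrightarrow> cmod (g (opmult d (opadj x))) \<le> opnorm d / K" for g
    proof (rule small[where \<tau> = "\<lambda>a. opmult a (opadj x)",
          OF selfadjoint_corner(2)[OF A proj x g] _ le])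
      show "(\<lambda>a. if a \<in> A then g (opmult a (opadj x)) else 0) \<in> dual A"
        using dual_BH_restrict[OF A fmod_l_dual[OF subalgebra_BH_BH g x']] A_BH
        by (simp add: fmod_l_def subset_iff cong: if_cong)
    qed
    then show ?thesis
      using bounded_approximation[of ?D "\<lambda>d. opmult d (opadj x)" "opadj x" K \<delta>] D D_BH K(2) \<delta> x'
      by (simp add: opmult_plus_left opmult_opscale_left subset_iff)
  qed
  show ?thesis using that K(1) left right by blast
qed

lemma functional_perturbation:
  assumes A: "subalgebra_BH A" and g: "op_linear_on A g"
    and N: "N \<ge> 0" "\<And>a. a \<in> A \<Longrightarrow> cmod (g a) \<le> N * opnorm a"
    and \<epsilon>: "\<epsilon> > 0" and x: "x \<in> A" "g x = of_real r" "N - \<epsilon>\<^sup>2 \<le> r" and y: "y \<in> A" and s: "s \<ge> 0"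
    and bound: "\<And>b. cmod b = \<epsilon> \<Longrightarrow> (opnorm (x + opscale b y))\<^sup>2 \<le> 1 + \<epsilon>\<^sup>2 * s"
  shows "cmod (g y) \<le> \<epsilon> * (1 + N * s / 2)"
proof -
  note sub = subalgebra_BH_subspace[OF A]
  obtain b where b: "cmod b = 1" "b * g y = of_real (cmod (g y))" using ex_phase by blast
  define c where "c = of_real \<epsilon> * b"
  have c: "cmod c = \<epsilon>" using b \<epsilon> by (simp add: c_def norm_mult)
  have cy: "opscale c y \<in> A" by (rule op_subspace_scale[OF sub y])
  have "g (x + opscale c y) = g x + c * g y"
    using op_linear_on_add[OF g x(1) cy] op_linear_on_scale[OF sub g y] by simp
  also have "\<dots> = of_real (r + \<epsilon> * cmod (g y))"
    using b(2) x(2) by (simp add: c_def mult.assoc)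
  finally have "r + \<epsilon> * cmod (g y) \<le> cmod (g (x + opscale c y))"
    by (simp only: norm_of_real)
  also have "\<dots> \<le> N * opnorm (x + opscale c y)" by (intro N op_subspace_add sub x cy)
  also have "\<dots> \<le> N * (1 + \<epsilon>\<^sup>2 * s / 2)"
  proof (intro mult_left_mono N power2_le_imp_le[of "opnorm (x + opscale c y)"])
    have "(opnorm (x + opscale c y))\<^sup>2 \<le> 1 + \<epsilon>\<^sup>2 * s" by (rule bound[OF c])
    also have "\<dots> \<le> (1 + \<epsilon>\<^sup>2 * s / 2)\<^sup>2"
      using zero_le_power2[of "\<epsilon>\<^sup>2 * s / 2"] by (simp add: power2_sum)
    finally show "(opnorm (x + opscale c y))\<^sup>2 \<le> (1 + \<epsilon>\<^sup>2 * s / 2)\<^sup>2" .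
  qed (use s in simp)
  finally have "\<epsilon> * cmod (g y) \<le> \<epsilon> * (\<epsilon> * (1 + N * s / 2))"
    using x(3) by (simp add: power2_eq_square algebra_simps)
  then show ?thesis using \<epsilon> by simp
qed

text \<open>The cross term is b (x^* - x^* d) a, of norm at most \<epsilon>^2 R: one \<epsilon>
  comes from b, the other from the choice of d. It contributes 2 R, and the square of a - d a
  contributes (R + K R)^2.\<close>

lemma opnorm_left_perturbation:
  assumes x: "x \<in> BH" "opnorm x \<le> 1" and d: "d \<in> BH" "opnorm d \<le> K"
    and a: "a \<in> BH" "opnorm a \<le> R" and \<epsilon>: "\<epsilon> > 0"
    and \<delta>: "opnorm (opadj x - opmult (opadj x) d) \<le> \<epsilon>" and b: "cmod b = \<epsilon>"
  shows "(opnorm (x + opscale b (a - opmult d a)))\<^sup>2 \<le> 1 + \<epsilon>\<^sup>2 * ((R + K * R)\<^sup>2 + 2 * R)"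
proof -
  let ?y = "a - opmult d a"
  have y: "?y \<in> BH" using a d by simp
  have R: "R \<ge> 0" using a opnorm_nonneg[of a] by linarith
  have K: "K \<ge> 0" using d opnorm_nonneg[of d] by linarith
  have "opnorm ?y \<le> R + K * R"
    using opnorm_minus_le[OF a(1) BH_opmult(1)[OF d(1) a(1)]] opnorm_opmult_le[OF d(1) a(1)] a
      mult_mono[OF d(2) a(2) K opnorm_nonneg[OF a(1)]] by linarith
  then have "(opnorm (opscale b ?y))\<^sup>2 \<le> (\<epsilon> * (R + K * R))\<^sup>2"
    using \<epsilon> y b by (intro power_mono) (simp_all add: opnorm_opscale)
  moreover have "opnorm (opmult (opadj x) (opscale b ?y)) \<le> \<epsilon> * (\<epsilon> * R)"
  proof -
    have "opmult (opadj x) (opscale b ?y) = opscale b (opmult (opadj x - opmult (opadj x) d) a)"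
      using x a d y by (simp add: opmult_opscale_right opmult_minus_right opmult_minus_left opmult_assoc)
    then have "opnorm (opmult (opadj x) (opscale b ?y))
        = \<epsilon> * opnorm (opmult (opadj x - opmult (opadj x) d) a)"
      using x a d b by (simp add: opnorm_opscale)
    also have "\<dots> \<le> \<epsilon> * (opnorm (opadj x - opmult (opadj x) d) * opnorm a)"
      using \<epsilon> x a d by (intro mult_left_mono opnorm_opmult_le) auto
    also have "\<dots> \<le> \<epsilon> * (\<epsilon> * R)"
      using \<epsilon> \<delta> a by (intro mult_left_mono mult_mono) auto
    finally show ?thesis .
  qed
  moreover have "(opnorm x)\<^sup>2 \<le> 1" using x by (simp add: power_le_one)
  ultimately show ?thesis
    using opnorm_add_square_le[OF x(1) BH_opscale(1)[OF y, of b]]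
    by (simp add: power_mult_distrib power2_eq_square algebra_simps)
qed

text \<open>Adjoints preserve the norm and reverse products, so this is the left version for x^*,
  d^*, a^* and the conjugate of b. The hypothesis on d matches because x - x d^* has adjoint x^* - d
  x^*.\<close>

lemma opnorm_right_perturbation:
  assumes x: "x \<in> BH" "opnorm x \<le> 1" and d: "d \<in> BH" "opnorm d \<le> K"
    and a: "a \<in> BH" "opnorm a \<le> R" and \<epsilon>: "\<epsilon> > 0"
    and \<delta>: "opnorm (opadj x - opmult d (opadj x)) \<le> \<epsilon>" and b: "cmod b = \<epsilon>"
  shows "(opnorm (x + opscale b (a - opmult a d)))\<^sup>2 \<le> 1 + \<epsilon>\<^sup>2 * ((R + K * R)\<^sup>2 + 2 * R)"
proof -
  have sub: "opadj (S - T) = opadj S - opadj T" if "S \<in> BH" "T \<in> BH" for S T :: "'a op"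
    using opadj_plus[of "S - T" T] that by simp
  have "opadj (x + opscale b (a - opmult a d))
      = opadj x + opscale (cnj b) (opadj a - opmult (opadj d) (opadj a))"
    using x d a by (simp add: opadj_plus opadj_opscale opadj_opmult sub)
  moreover have "opnorm (opadj (opadj x) - opmult (opadj (opadj x)) (opadj d)) \<le> \<epsilon>"
  proof -
    have "opadj (opadj (opadj x) - opmult (opadj (opadj x)) (opadj d)) = opadj x - opmult d (opadj x)"
      using x d by (simp add: opadj_opmult sub)
    then show ?thesis using \<delta> x d
      by (metis BH_minus BH_opmult(1) opadj_BH opnorm_opadj)
  qed
  ultimately show ?thesis
    using opnorm_left_perturbation[of "opadj x" "opadj d" K "opadj a" R \<epsilon> "cnj b"] assms
    by (metis BH_minus BH_opmult(1) BH_opscale(1) BH_plus(1) complex_mod_cnj opadj_BH opnorm_opadj)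
qed

lemma almost_norming:
  assumes V: "op_subspace V" "V \<subseteq> BH" and f: "f \<in> dual V" and \<eta>: "\<eta> > 0"
  obtains x r where "x \<in> V" "opnorm x \<le> 1" "f x = of_real r" "fnorm V f - \<eta> \<le> r"
proof -
  have "{cmod (f a) | a. a \<in> V \<and> opnorm a \<le> 1} \<noteq> {}"
    using op_subspace_0[OF V(1)] opnorm_zero zero_le_one by (metis (mono_tags, lifting) empty_Collect_eq)
  moreover have "fnorm V f - \<eta> < fnorm V f" using \<eta> by simp
  ultimately obtain z where z: "z \<in> V" "opnorm z \<le> 1" "fnorm V f - \<eta> < cmod (f z)"
    unfolding fnorm_def using less_cSupD[of "{cmod (f a) | a. a \<in> V \<and> opnorm a \<le> 1}"] by blast
  obtain b where b: "cmod b = 1" "b * f z = of_real (cmod (f z))" using ex_phase by blast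
  have "f (opscale b z) = of_real (cmod (f z))"
    using op_linear_on_scale[OF V(1) dual_linear[OF f] z(1)] b(2) by simp
  moreover have "opnorm (opscale b z) = opnorm z" using z V b by (simp add: opnorm_opscale subset_iff)
  ultimately show ?thesis
    using that[of "opscale b z" "cmod (f z)"] z op_subspace_scale[OF V(1) z(1)] by simp
qed

lemma norm_preserving_extension_unique:
  assumes A: "subalgebra_BH A" and p: "open_projection A p" and f: "f \<in> dual (corner A p)"
    and g: "g \<in> dual A" "\<And>d. d \<in> corner A p \<Longrightarrow> g d = f d" "fnorm A g = fnorm (corner A p) f"
    and h: "h \<in> dual A" "\<And>d. d \<in> corner A p \<Longrightarrow> h d = f d" "fnorm A h = fnorm (corner A p) f"
    and a: "a \<in> A"
  shows "g a = h a"
proof -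
  let ?D = "corner A p" and ?N = "fnorm (corner A p) f"
  have p_bid: "p \<in> bidual A" "arens A p p = p"
    using p by (auto simp: open_projection_def projection_bidual_def)
  note D = op_subspace_corner[OF A p_bid] and sub = subalgebra_BH_subspace[OF A]
  have DA: "d \<in> A" if "d \<in> ?D" for d using that by (simp add: corner_def)
  note A_BH = subalgebra_BH_in_BH[OF A]
  have A_sub: "A \<subseteq> BH" and D_sub: "?D \<subseteq> BH" using A_BH DA by auto
  have N: "?N \<ge> 0" by (rule fnorm_nonneg[OF D D_sub f])
  obtain K where K: "K \<ge> 1"
    and left: "\<And>x \<delta>. x \<in> ?D \<Longrightarrow> \<delta> > 0 \<Longrightarrow>
      \<exists>d\<in>?D. opnorm d \<le> K \<and> opnorm (opadj x - opmult (opadj x) d) \<le> \<delta>"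
    and right: "\<And>x \<delta>. x \<in> ?D \<Longrightarrow> \<delta> > 0 \<Longrightarrow>
      \<exists>d\<in>?D. opnorm d \<le> K \<and> opnorm (opadj x - opmult d (opadj x)) \<le> \<delta>"
    using corner_approximate_identity[OF A p] by blast
  \<comment> \<open>Bounds both a, as \<open>K \<ge> 1\<close>, and d a, as d has norm at most
    \<open>K\<close>; the left cut of a and the right cut of d a then share the constant s.\<close>
  define R where "R = K * opnorm a"
  define s where "s = (R + K * R)\<^sup>2 + 2 * R"
  define C where "C = 1 + ?N * s / 2"
  have R: "R \<ge> 0" "opnorm a \<le> R"
    using K opnorm_nonneg[OF A_BH[OF a]] mult_right_mono[of 1 K "opnorm a"] by (auto simp: R_def)
  have s: "s \<ge> 0" using R by (simp add: s_def)
  have est: "cmod (g a - h a) \<le> \<epsilon> * (4 * C)" if \<epsilon>: "\<epsilon> > 0" for \<epsilon>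
  proof -
    obtain x r where x: "x \<in> ?D" "opnorm x \<le> 1" "f x = of_real r" "?N - \<epsilon>\<^sup>2 \<le> r"
      using almost_norming[OF D D_sub f, of "\<epsilon>\<^sup>2"] \<epsilon> by auto
    obtain d where d: "d \<in> ?D" "opnorm d \<le> K" "opnorm (opadj x - opmult (opadj x) d) \<le> \<epsilon>"
      using left[OF x(1) \<epsilon>] by blast
    obtain e where e: "e \<in> ?D" "opnorm e \<le> K" "opnorm (opadj x - opmult e (opadj x)) \<le> \<epsilon>"
      using right[OF x(1) \<epsilon>] by blast
    let ?da = "opmult d a"
    have da: "?da \<in> A" and dae: "opmult ?da e \<in> A"
      using a DA[OF d(1)] DA[OF e(1)] by (auto intro!: subalgebra_BH_mult[OF A])
    have "opnorm ?da \<le> R"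
      using opnorm_opmult_le[OF A_BH[OF DA[OF d(1)]] A_BH[OF a]]
        mult_right_mono[OF d(2) opnorm_nonneg[OF A_BH[OF a]]] by (simp add: R_def)
    \<comment> \<open>The elements x, d and e were chosen from f and \<epsilon> alone, so the same d
      a e serves every norm-preserving extension k, in particular both g and h.\<close>
    then have bounds: "cmod (k (a - ?da)) \<le> \<epsilon> * C \<and> cmod (k (?da - opmult ?da e)) \<le> \<epsilon> * C"
      if k: "k \<in> dual A" "\<And>d. d \<in> ?D \<Longrightarrow> k d = f d" "fnorm A k = ?N" for k
      unfolding C_def
      using opnorm_left_perturbation[OF A_BH[OF DA[OF x(1)]] x(2) A_BH[OF DA[OF d(1)]] d(2)
          A_BH[OF a] R(2) \<epsilon> d(3)]
        opnorm_right_perturbation[OF A_BH[OF DA[OF x(1)]] x(2) A_BH[OF DA[OF e(1)]] e(2)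
          A_BH[OF da] _ \<epsilon> e(3), of R]
        fnorm_bound[OF sub A_sub k(1)] k(2)[OF x(1)] x(3)
      by (intro conjI functional_perturbation[OF A dual_linear[OF k(1)] N _ \<epsilon> DA[OF x(1)] _ x(4) _ s])
        (auto simp: k(3) s_def intro!: op_subspace_diff[OF sub] a da dae)
    have split: "cmod (k a - k (opmult ?da e)) \<le> \<epsilon> * (2 * C)"
      if k: "k \<in> dual A" "\<And>d. d \<in> ?D \<Longrightarrow> k d = f d" "fnorm A k = ?N" for k
    proof -
      note lin = op_linear_on_diff[OF sub dual_linear[OF k(1)]]
      have "k a - k (opmult ?da e) = k (a - ?da) + k (?da - opmult ?da e)"
        by (simp add: lin[OF a da] lin[OF da dae])
      then have "cmod (k a - k (opmult ?da e)) \<le> cmod (k (a - ?da)) + cmod (k (?da - opmult ?da e))"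
        by (simp add: norm_triangle_ineq)
      then show ?thesis using bounds[OF k] by linarith
    qed
    have "g (opmult ?da e) = h (opmult ?da e)"
      using corner_hereditary[OF A p_bid d(1) e(1) a] g(2) h(2) by simp
    then have "g a - h a = (g a - g (opmult ?da e)) - (h a - h (opmult ?da e))" by simp
    also have "cmod \<dots> \<le> \<epsilon> * (2 * C) + \<epsilon> * (2 * C)"
      using norm_triangle_ineq4 split[OF g] split[OF h] by (metis (no_types) add_mono order_trans)
    finally show ?thesis by (simp add: algebra_simps)
  qed
  have C: "C > 0" using N s by (simp add: C_def add_pos_nonneg)
  have "cmod (g a - h a) \<le> 0"
  proof (rule field_le_epsilon)
    fix e :: real assume "e > 0"
    then show "cmod (g a - h a) \<le> 0 + e" using est[of "e / (4 * C)"] C by simp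
  qed
  then show ?thesis by simp
qed

text \<open>Hahn-Banach with the dominating seminorm |f| |x| gives norm at most |f|; since the
  extension restricts to f, its norm cannot be smaller.\<close>

lemma norm_preserving_extension_exists:
  assumes A: "subalgebra_BH A" and D: "op_subspace D" "D \<subseteq> A" and f: "f \<in> dual D"
  obtains g where "g \<in> dual A" "\<And>d. d \<in> D \<Longrightarrow> g d = f d" "fnorm A g = fnorm D f"
proof -
  note sub = subalgebra_BH_subspace[OF A] and A_BH = subalgebra_BH_in_BH[OF A]
  have A_sub: "A \<subseteq> BH" and D_sub: "D \<subseteq> BH" using A_BH D(2) by auto
  have N: "fnorm D f \<ge> 0" by (rule fnorm_nonneg[OF D(1) D_sub f])
  obtain g where g: "op_linear_on A g" "\<And>x. x \<in> A \<Longrightarrow> cmod (g x) \<le> fnorm D f * opnorm x"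
      "\<And>x. x \<in> D \<Longrightarrow> g x = f x"
  proof (rule hahn_banach_complex[OF sub D, of "\<lambda>x. fnorm D f * opnorm x" f])
    show "fnorm D f * opnorm (x + y) \<le> fnorm D f * opnorm x + fnorm D f * opnorm y"
      if "x \<in> A" "y \<in> A" for x y
      using mult_left_mono[OF opnorm_triangle[OF A_BH[OF that(1)] A_BH[OF that(2)]] N]
      by (simp add: distrib_left)
    show "fnorm D f * opnorm (opscale c x) = cmod c * (fnorm D f * opnorm x)" if "x \<in> A" for x c
      using opnorm_opscale[OF A_BH[OF that]] by simp
    show "op_linear_on D f" by (rule dual_linear[OF f])
    show "cmod (f x) \<le> fnorm D f * opnorm x" if "x \<in> D" for x by (rule fnorm_bound[OF D(1) D_sub f that])
  qed blast
  define h where "h = (\<lambda>a. if a \<in> A then g a else 0)"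
  have h: "h \<in> dual A" unfolding h_def by (rule dual_restrictI[OF sub g(1,2)])
  have hf: "h d = f d" if "d \<in> D" for d using that D(2) g(3) by (auto simp: h_def)
  have "fnorm A h \<le> fnorm D f" by (rule fnorm_le[OF sub N]) (simp add: h_def g(2))
  moreover have "fnorm D f \<le> fnorm A h"
    by (rule fnorm_le[OF D(1) fnorm_nonneg[OF sub A_sub h]])
      (use fnorm_bound[OF sub A_sub h] hf D(2) in \<open>metis subsetD\<close>)
  ultimately show ?thesis using that[OF h hf] by simp
qed

theorem theorem2p8:
  fixes A D :: "'i op set"
  assumes "operator_algebra A"
    and "approx_unital A"
    and "hereditary_subalgebra A D"
    and "f \<in> dual D"
  shows "\<exists>!g. g \<in> dual A \<and> (\<forall>d\<in>D. g d = f d) \<and> fnorm A g = fnorm D f"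
proof -
  have A: "subalgebra_BH A" using assms(1) by (simp add: operator_algebra_def)
  obtain p where p: "open_projection A p" and D: "D = corner A p"
    using assms(3) by (auto simp: hereditary_subalgebra_def)
  have f: "f \<in> dual (corner A p)" using assms(4) D by simp
  have "op_subspace D"
    using p D op_subspace_corner[OF A] by (simp add: open_projection_def projection_bidual_def)
  moreover have "D \<subseteq> A" by (auto simp: D corner_def)
  ultimately obtain g where g: "g \<in> dual A" "\<And>d. d \<in> D \<Longrightarrow> g d = f d" "fnorm A g = fnorm D f"
    using norm_preserving_extension_exists[OF A _ _ assms(4)] by blast
  show ?thesis
  proof (rule ex1I[of _ g])
    show "h = g" if h: "h \<in> dual A \<and> (\<forall>d\<in>D. h d = f d) \<and> fnorm A h = fnorm D f" for h
    proof
      fix a show "h a = g a"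
      \<comment> \<open>Equality is one of functions on all operators; outside \<open>A\<close> both
        sides are 0 by the convention in \<open>dual\<close>.\<close>
      proof (cases "a \<in> A")
        case True
        then show ?thesis
          using norm_preserving_extension_unique[OF A p f, of h g a] g h by (simp add: D)
      qed (use g(1) h in \<open>simp add: dual_iff\<close>)
    qed
  qed (use g in auto)
qed

end
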